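(* Let $u=x_1^{a_1}\cdots x_n^{a_n}$ with $a_1>0$, and $v=x_1^{b_1}\cdots x_n^{b_n}$ be monomials of degree $d\ge 2$ in $S=k[x_1,\ldots,x_n]$ with $u\geq_{lex} v$, and let $I=(\mathcal{L}(u,v))$ be a completely lexsegment ideal. Then $I$ has a linear resolution if and only if $I$ has linear quotients.
   Context: $S=k[x_1,\ldots,x_n]$ is a polynomial ring over a field $k$, with monomials ordered lexicographically with $x_1>x_2>\cdots>x_n$. $d\geq 2$ is an integer and $\mathcal{M}_d$ is the set of monomials of degree $d$ in $S$. For $u,v\in\mathcal{M}_d$ with $u\geq_{lex}v$, the lexsegment is $\mathcal{L}(u,v)=\{w\in\mathcal{M}_d : u\geq_{lex}w\geq_{lex}v\}$. The ideal $(\mathcal{L}(u,v))$ it generates is called a lexsegment ideal; its minimal monomial generating set is $\mathcal{L}(u,v)$. The shadow of a set $T$ of monomials is $\mathrm{Shad}(T)=\{m x_i : m\in T,\ 1\le i\le n\}$, and $\mathrm{Shad}^i(T)=\mathrm{Shad}(\mathrm{Shad}^{i-1}(T))$. A lexsegment is a completely lexsegment if all its iterated shadows $\mathrm{Shad}^i$ are again lexsegments; a completely lexsegment ideal is an ideal generated by a completely lexsegment. An ideal generated in degree $d$ has a linear resolution if its $i$-th module in the minimal graded free resolution over $S$ is generated in degree $d+i$ for all $i\ge 0$. A monomial ideal $I$ with minimal monomial generating set $G(I)$ has linear quotients if there is an ordering $u_1,\ldots,u_m$ of $G(I)$ such that for all $2\le j\le m$ the colon ideal $(u_1,\ldots,u_{j-1}):u_j$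 is generated by a subset of $\{x_1,\ldots,x_n\}$. *)

theory Defs
  imports Complex_Main "HOL-Library.Poly_Mapping"
begin

text \<open>
  The polynomial ring \<open>k[x\<^sub>1, \<dots>, x\<^sub>n]\<close> is the convolution ring \<open>('n \<Rightarrow>\<^sub>0 nat) \<Rightarrow>\<^sub>0 'k\<close>, where the
  variables are indexed by a finite linearly ordered type \<open>'n\<close> with \<open>n\<close> elements; the least index
  \<open>Min UNIV\<close> plays the role of \<open>1\<close>.  Monomials are identified with their exponent vectors, so
  \<open>+\<close> on exponent vectors is multiplication of monomials.

  The order \<open>\<le>\<close> that \<open>HOL-Library.Poly_Mapping\<close> puts on \<open>'n \<Rightarrow>\<^sub>0 nat\<close> is lexicographic and decided at
  the least index where two exponent vectors differ, i.e. it is the lexicographic monomial order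
  with \<open>x\<^sub>1 > x\<^sub>2 > \<dots> > x\<^sub>n\<close>.
\<close>

type_synonym 'n pmonom = "'n \<Rightarrow>\<^sub>0 nat"
type_synonym ('n, 'k) poly_ring = "('n \<Rightarrow>\<^sub>0 nat) \<Rightarrow>\<^sub>0 'k"

definition mdeg :: "'n::finite pmonom \<Rightarrow> nat" where
  "mdeg t = (\<Sum>i\<in>UNIV. Poly_Mapping.lookup t i)"

abbreviation mvar :: "'n \<Rightarrow> 'n pmonom" where
  "mvar i \<equiv> Poly_Mapping.single i 1"

definition mono_poly :: "'n pmonom \<Rightarrow> ('n, 'k::field) poly_ring" where
  "mono_poly t = Poly_Mapping.single t 1"

definition ideal_gen :: "('n, 'k::field) poly_ring set \<Rightarrow> ('n, 'k) poly_ring set" where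
  "ideal_gen B = module.span (*) B"

definition monomial_ideal :: "'n pmonom set \<Rightarrow> ('n, 'k::field) poly_ring set" where
  "monomial_ideal T = ideal_gen (mono_poly ` T)"


section \<open>Lexsegments\<close>

definition lexsegment :: "'n::{finite,linorder} pmonom \<Rightarrow> 'n pmonom \<Rightarrow> 'n pmonom set" where
  "lexsegment u v = {w. mdeg w = mdeg u \<and> v \<le> w \<and> w \<le> u}"

definition is_lexsegment :: "'n::{finite,linorder} pmonom set \<Rightarrow> bool" where
  "is_lexsegment T \<longleftrightarrow> (\<exists>u v. mdeg u = mdeg v \<and> v \<le> u \<and> T = lexsegment u v)"

definition Shad :: "'n pmonom set \<Rightarrow> 'n pmonom set" where
  "Shad T = {m + mvar i | m i. m \<in> T}"

definition completely_lexsegment :: "'n::{finite,linorder} pmonom set \<Rightarrow> bool" where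
  "completely_lexsegment T \<longleftrightarrow> (\<forall>i. is_lexsegment ((Shad ^^ i) T))"

definition completely_lexsegment_ideal ::
  "('n::{finite,linorder}, 'k::field) poly_ring set \<Rightarrow> bool" where
  "completely_lexsegment_ideal I \<longleftrightarrow> (\<exists>T. completely_lexsegment T \<and> I = monomial_ideal T)"


section \<open>Linear quotients\<close>

definition minimal_monomial_generating_set ::
  "('n, 'k::field) poly_ring set \<Rightarrow> 'n pmonom set \<Rightarrow> bool" where
  "minimal_monomial_generating_set I G \<longleftrightarrow>
     I = monomial_ideal G \<and> (\<forall>G'. G' \<subset> G \<longrightarrow> I \<noteq> monomial_ideal G')"

definition colon :: "('n, 'k::field) poly_ring set \<Rightarrow> ('n, 'k) poly_ring \<Rightarrow> ('n, 'k) poly_ring set" where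
  "colon J f = {g. g * f \<in> J}"

text \<open>The list \<open>us\<close> is indexed from \<open>0\<close>: \<open>take j us\<close> are the generators preceding \<open>us ! j\<close>.\<close>

definition has_linear_quotients :: "('n, 'k::field) poly_ring set \<Rightarrow> bool" where
  "has_linear_quotients I \<longleftrightarrow>
     (\<exists>us. distinct us \<and> minimal_monomial_generating_set I (set us) \<and>
        (\<forall>j. 1 \<le> j \<and> j < length us \<longrightarrow>
           (\<exists>V. colon (monomial_ideal (set (take j us))) (mono_poly (us ! j) :: ('n, 'k) poly_ring)
                  = monomial_ideal (mvar ` V))))"


section \<open>Minimal graded free resolutions\<close>

definition homogeneous :: "int \<Rightarrow> ('n::finite, 'k::field) poly_ring \<Rightarrow> bool" where
  "homogeneous m f \<longleftrightarrow> (\<forall>t\<in>Poly_Mapping.keys f. int (mdeg t) = m)"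

definition irrelevant_ideal :: "('n, 'k::field) poly_ring set" where
  "irrelevant_ideal = monomial_ideal (range mvar)"

text \<open>
  The free module of rank \<open>r\<close>, with elements given by their coordinate functions, and the linear map
  \<open>S\<^bsup>r\<^esup> \<rightarrow> S\<^bsup>q\<^esup>\<close> with matrix \<open>A\<close>, whose entry \<open>A j l\<close> is the \<open>j\<close>-th coordinate of the image of the \<open>l\<close>-th
  basis element.
\<close>

definition free_module :: "nat \<Rightarrow> (nat \<Rightarrow> ('n, 'k::field) poly_ring) set" where
  "free_module r = {c. \<forall>j\<ge>r. c j = 0}"

definition mat_map :: "nat \<Rightarrow> nat \<Rightarrow> (nat \<Rightarrow> nat \<Rightarrow> ('n, 'k::field) poly_ring) \<Rightarrow>
    (nat \<Rightarrow> ('n, 'k) poly_ring) \<Rightarrow> nat \<Rightarrow> ('n, 'k) poly_ring" where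
  "mat_map q r A c = (\<lambda>j. if j < q then (\<Sum>l<r. A j l * c l) else 0)"

text \<open>
  A graded free resolution
  \<open>\<cdots> \<rightarrow> F\<^sub>2 \<rightarrow> F\<^sub>1 \<rightarrow> F\<^sub>0 \<rightarrow> I \<rightarrow> 0\<close> of an ideal \<open>I\<close> by finitely generated free modules.  The module
  \<open>F\<^sub>i\<close> is the direct sum of the shifted modules \<open>S(- e i j)\<close> for \<open>j < r i\<close>, i.e. it has rank \<open>r i\<close> and
  its \<open>j\<close>-th basis element has degree \<open>e i j\<close>; \<open>\<epsilon>\<close> gives the images in \<open>I\<close> of the basis elements of
  \<open>F\<^sub>0\<close>, and
  \<open>D i\<close> is the matrix of \<open>F\<^bsub>i+1\<^esub> \<rightarrow> F\<^sub>i\<close>.  All maps are homogeneous of degree \<open>0\<close>.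
\<close>

definition graded_free_resolution ::
  "('n::finite, 'k::field) poly_ring set \<Rightarrow> (nat \<Rightarrow> nat) \<Rightarrow> (nat \<Rightarrow> nat \<Rightarrow> int) \<Rightarrow>
    (nat \<Rightarrow> ('n, 'k) poly_ring) \<Rightarrow> (nat \<Rightarrow> nat \<Rightarrow> nat \<Rightarrow> ('n, 'k) poly_ring) \<Rightarrow> bool" where
  "graded_free_resolution I r e \<epsilon> D \<longleftrightarrow>
     (\<forall>j<r 0. homogeneous (e 0 j) (\<epsilon> j)) \<and>
     (\<forall>i. \<forall>j<r i. \<forall>l<r (Suc i). homogeneous (e (Suc i) l - e i j) (D i j l)) \<and>
     (\<lambda>c. \<Sum>j<r 0. c j * \<epsilon> j) ` free_module (r 0) = I \<and>
     {c \<in> free_module (r 0). (\<Sum>j<r 0. c j * \<epsilon> j) = 0}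
       = mat_map (r 0) (r 1) (D 0) ` free_module (r 1) \<and>
     (\<forall>i. {c \<in> free_module (r (Suc i)). mat_map (r i) (r (Suc i)) (D i) c = (\<lambda>_. 0)}
       = mat_map (r (Suc i)) (r (Suc (Suc i))) (D (Suc i)) ` free_module (r (Suc (Suc i))))"

text \<open>
  Minimality: \<open>F\<^bsub>i+1\<^esub>\<close> is mapped into \<open>(x\<^sub>1, \<dots>, x\<^sub>n) F\<^sub>i\<close>.
\<close>

definition minimal_graded_free_resolution ::
  "('n::finite, 'k::field) poly_ring set \<Rightarrow> (nat \<Rightarrow> nat) \<Rightarrow> (nat \<Rightarrow> nat \<Rightarrow> int) \<Rightarrow>
    (nat \<Rightarrow> ('n, 'k) poly_ring) \<Rightarrow> (nat \<Rightarrow> nat \<Rightarrow> nat \<Rightarrow> ('n, 'k) poly_ring) \<Rightarrow> bool" where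
  "minimal_graded_free_resolution I r e \<epsilon> D \<longleftrightarrow>
     graded_free_resolution I r e \<epsilon> D \<and>
     (\<forall>i. \<forall>j<r i. \<forall>l<r (Suc i). D i j l \<in> irrelevant_ideal)"

text \<open>
  The minimal graded free resolution of an ideal is unique up to isomorphism, hence the existential
  quantifier.  The graded free module \<open>F\<^sub>i\<close> is generated in degree \<open>d + i\<close> iff all its basis elements
  have that degree; for \<open>i = 0\<close> this includes that \<open>I\<close> is generated in degree \<open>d\<close>.
\<close>

definition has_linear_resolution :: "nat \<Rightarrow> ('n::finite, 'k::field) poly_ring set \<Rightarrow> bool" where
  "has_linear_resolution d I \<longleftrightarrow>
     (\<exists>r e \<epsilon> D. minimal_graded_free_resolution I r e \<epsilon> D \<and>
        (\<forall>i. \<forall>j<r i. e i j = int (d + i)))"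

end

theory Submission
  imports Defs "HOL-Library.Function_Algebras" "HOL-Library.FuncSet"
begin

text \<open>
  Write \<open>L\<close> for the lexsegment and consider the condition
  (C): \<open>x\<^sub>n p / x\<^sub>1 \<ge> v\<close> for every monomial \<open>p > u\<close> of degree \<open>d\<close> with the same \<open>x\<^sub>1\<close>-exponent as \<open>u\<close>.
  The implications are: linear resolution \<open>\<Longrightarrow>\<close> (C) \<open>\<Longrightarrow>\<close> linear quotients \<open>\<Longrightarrow>\<close> linear resolution.

  An ideal generated in degree \<open>d\<close> has a linear resolution iff the Koszul homology \<open>H\<^sub>i(x; I)\<close>
  vanishes outside internal degree \<open>d\<close>, by dimension shifting along the syzygy modules and the
  acyclicity of the Koszul complex of \<open>S\<close>.  If (C) fails for \<open>p\<close>, then \<open>p x\<^sub>i\<close> lies in the shadow of \<open>L\<close>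
  for all \<open>i \<ge> 2\<close> because \<open>L\<close> is a completely lexsegment, and the boundary of \<open>p e\<^sub>2 \<and> \<dots> \<and> e\<^sub>n\<close> is a
  cycle in the wrong degree that is not a boundary.  Under (C) the colon ideals are generated by
  variables when \<open>L\<close> is ordered by ascending \<open>x\<^sub>1\<close>-exponent, and by descending lexicographic order for
  equal \<open>x\<^sub>1\<close>-exponents.  Finally, adding a generator \<open>m\<close> with \<open>J : m\<close> generated by variables keeps
  the Koszul homology concentrated, since this holds for the Koszul complex of \<open>S / (J : m)\<close>.
\<close>

section \<open>Monomials and monomial ideals\<close>

declare One_nat_def [simp del] \<comment> \<open>keeps \<open>mvar i = Poly_Mapping.single i 1\<close> foldable\<close>

abbreviation lookup where "lookup \<equiv> Poly_Mapping.lookup"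
abbreviation keys where "keys \<equiv> Poly_Mapping.keys"

definition mdvd :: "'n pmonom \<Rightarrow> 'n pmonom \<Rightarrow> bool" where
  "mdvd s t \<longleftrightarrow> (\<exists>r. t = s + r)"

lemma mdvd_iff: "mdvd s t \<longleftrightarrow> (\<forall>i. lookup s i \<le> lookup t i)"
proof
  assume "\<forall>i. lookup s i \<le> lookup t i"
  then have "t = s + (t - s)"
    by (intro poly_mapping_eqI) (simp add: lookup_add lookup_minus)
  then show "mdvd s t" unfolding mdvd_def by blast
qed (auto simp: mdvd_def lookup_add)

lemma mdvd_refl [simp]: "mdvd t t"
  by (simp add: mdvd_iff)

lemma mdvd_trans: "mdvd r s \<Longrightarrow> mdvd s t \<Longrightarrow> mdvd r t"
  by (meson mdvd_iff order_trans)

lemma mdvd_antisym: "mdvd s t \<Longrightarrow> mdvd t s \<Longrightarrow> s = t"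
  by (intro poly_mapping_eqI) (simp add: mdvd_iff order_antisym)

lemma mdvd_mvar_iff: "mdvd (mvar i) t \<longleftrightarrow> 0 < lookup t i"
  by (auto simp: mdvd_iff lookup_single when_def Suc_le_eq)

lemma minus_mvar_add: "0 < lookup t i \<Longrightarrow> t - mvar i + mvar i = t"
  by (intro poly_mapping_eqI) (auto simp: lookup_add lookup_minus lookup_single when_def)

lemma mdeg_add: "mdeg (s + t) = mdeg s + mdeg t"
  by (simp add: mdeg_def lookup_add sum.distrib)

lemma mdeg_mvar [simp]: "mdeg (mvar i) = 1"
  by (simp add: mdeg_def lookup_single when_def)

lemma mdeg_eq_0_iff: "mdeg t = 0 \<longleftrightarrow> t = 0"
  by (auto simp: mdeg_def intro: poly_mapping_eqI)

lemma mdeg_minus_mvar: "0 < lookup t i \<Longrightarrow> mdeg (t - mvar i) = mdeg t - 1"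
  using mdeg_add[of "t - mvar i" "mvar i"] by (simp add: minus_mvar_add)

lemma mdvd_mdeg_eq: "mdvd s t \<Longrightarrow> mdeg s = mdeg t \<Longrightarrow> s = t"
  by (auto simp: mdvd_def mdeg_add mdeg_eq_0_iff)

text \<open>Each exponent is at most the degree, so the exponent functions lie in a finite
  box.\<close>

lemma finite_mdeg: "finite {t :: 'n::finite pmonom. mdeg t = g}"
proof -
  have "lookup ` {t :: 'n pmonom. mdeg t = g} \<subseteq> PiE UNIV (\<lambda>_. {..g})"
    unfolding mdeg_def by (auto intro!: member_le_sum)
  then have "finite (lookup ` {t :: 'n pmonom. mdeg t = g})"
    by (rule finite_subset) (simp add: finite_PiE)
  then show ?thesis
    by (rule finite_imageD) (meson inj_onI poly_mapping_eq_iff[THEN iffD2])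
qed

lemma lookup_single_mult:
  "lookup (Poly_Mapping.single (m :: 'n pmonom) (c :: 'k::field) * p) s =
     (if mdvd m s then c * lookup p (s - m) else 0)"
proof -
  have *: "s = m + q \<longleftrightarrow> mdvd m s \<and> q = s - m" for q
    by (auto simp: mdvd_def)
  have "lookup (Poly_Mapping.single m c * p) s =
      (\<Sum>l. lookup (Poly_Mapping.single m c) l * (\<Sum>q. lookup p q when s = l + q))"
    by (rule lookup_mult)
  also have "\<dots> = (\<Sum>l. (c * (\<Sum>q. lookup p q when s = m + q)) when l = m)"
    by (rule Sum_any.cong) (auto simp: lookup_single when_def)
  also have "\<dots> = c * (\<Sum>q. lookup p q when s = m + q)" by simp
  also have "(\<Sum>q. lookup p q when s = m + q) = (if mdvd m s then lookup p (s - m) else 0)"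
    unfolding * by (cases "mdvd m s") auto
  finally show ?thesis by simp
qed

lemma sum_single_keys: "(\<Sum>t\<in>keys p. Poly_Mapping.single t (lookup p t)) = p"
  by (intro poly_mapping_eqI) (auto simp: lookup_sum lookup_single when_def in_keys_iff)

interpretation ring_mod: module "(*) :: 'a::comm_ring_1 \<Rightarrow> 'a \<Rightarrow> 'a"
  by standard (auto simp: algebra_simps)

lemma subspace_keys_divisible:
  "ring_mod.subspace {p :: ('n, 'k::field) poly_ring. \<forall>t\<in>keys p. \<exists>m\<in>T. mdvd m t}"
proof (intro ring_mod.subspaceI; clarsimp)
  fix x y :: "('n, 'k) poly_ring" and t
  assume "\<forall>t\<in>keys x. \<exists>m\<in>T. mdvd m t" "\<forall>t\<in>keys y. \<exists>m\<in>T. mdvd m t" "t \<in> keys (x + y)"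
  then show "\<exists>m\<in>T. mdvd m t"
    using keys_add[of x y] by blast
next
  fix x y :: "('n, 'k) poly_ring" and t
  assume *: "\<forall>t\<in>keys y. \<exists>m\<in>T. mdvd m t" "t \<in> keys (x * y)"
  obtain a b where "t = a + b" "b \<in> keys y"
    using keys_mult[of x y] *(2) by blast
  then show "\<exists>m\<in>T. mdvd m t"
    using *(1) by (metis add.commute mdvd_def mdvd_trans)
qed

text \<open>Membership is decided term by term: the polynomials described form an ideal containing
  the generators, and conversely each of their terms is a multiple of a generator.\<close>

lemma monomial_ideal_iff:
  "p \<in> monomial_ideal T \<longleftrightarrow> (\<forall>t\<in>keys p. \<exists>m\<in>T. mdvd m t)"
    for p :: "('n, 'k::field) poly_ring"
proof
  assume "p \<in> monomial_ideal T"
  moreover have "ring_mod.span (mono_poly ` T) \<subseteq> {p :: ('n, 'k) poly_ring. \<forall>t\<in>keys p. \<exists>m\<in>T. mdvd m t}"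
    by (rule ring_mod.span_minimal[OF _ subspace_keys_divisible])
       (auto simp: mono_poly_def intro: mdvd_refl)
  ultimately show "\<forall>t\<in>keys p. \<exists>m\<in>T. mdvd m t"
    unfolding monomial_ideal_def ideal_gen_def by blast
next
  assume *: "\<forall>t\<in>keys p. \<exists>m\<in>T. mdvd m t"
  have "Poly_Mapping.single t (lookup p t) \<in> ring_mod.span (mono_poly ` T)" if "t \<in> keys p" for t
  proof -
    from * that obtain m where "m \<in> T" "mdvd m t" by blast
    then obtain r where "t = m + r" unfolding mdvd_def by blast
    then have "Poly_Mapping.single t (lookup p t) = Poly_Mapping.single r (lookup p t) * mono_poly m"
      by (simp add: mono_poly_def mult_single add.commute)
    then show ?thesis
      using \<open>m \<in> T\<close> by (simp add: ring_mod.span_scale ring_mod.span_base)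
  qed
  then have "(\<Sum>t\<in>keys p. Poly_Mapping.single t (lookup p t)) \<in> ring_mod.span (mono_poly ` T)"
    by (rule ring_mod.span_sum)
  then show "p \<in> monomial_ideal T"
    unfolding monomial_ideal_def ideal_gen_def sum_single_keys .
qed

lemma subspace_monomial_ideal: "ring_mod.subspace (monomial_ideal T)"
  by (simp add: monomial_ideal_def ideal_gen_def)

lemma mono_poly_in_monomial_ideal_iff:
  "(mono_poly t :: ('n, 'k::field) poly_ring) \<in> monomial_ideal T \<longleftrightarrow> (\<exists>m\<in>T. mdvd m t)"
  by (simp add: monomial_ideal_iff mono_poly_def)

lemma monomial_ideal_eq_iff:
  "(monomial_ideal T :: ('n, 'k::field) poly_ring set) = monomial_ideal T' \<longleftrightarrow>
     (\<forall>t. (\<exists>m\<in>T. mdvd m t) \<longleftrightarrow> (\<exists>m\<in>T'. mdvd m t))"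
  (is "?I = ?I' \<longleftrightarrow> ?R")
proof
  assume "?I = ?I'"
  then show ?R
    unfolding mono_poly_in_monomial_ideal_iff[where 'k = 'k, symmetric] by simp
next
  assume ?R
  then show "?I = ?I'"
    by (intro set_eqI) (simp add: monomial_ideal_iff)
qed

section \<open>Free modules and the Koszul complex\<close>

lemma sum_fun_apply: "(\<Sum>i\<in>A. f i) j = (\<Sum>i\<in>A. f i j)"
  for f :: "'a \<Rightarrow> 'b \<Rightarrow> 'c::comm_monoid_add"
  by (induction A rule: infinite_finite_induct) auto

text \<open>Vectors of all ranks live in the one type of functions on \<open>nat\<close>;
  \<open>free_module r\<close> cuts out those supported below \<open>r\<close>. This makes the
  general theory of spans and subspaces available.\<close>

definition vscale :: "('n, 'k::field) poly_ring \<Rightarrow> (nat \<Rightarrow> ('n, 'k) poly_ring) \<Rightarrow> nat \<Rightarrow> ('n, 'k) poly_ring" where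
  "vscale f x = (\<lambda>j. f * x j)"

interpretation vec: module vscale
proof (unfold_locales, goal_cases)
  case (1 a x y) then show ?case by (intro ext) (simp add: vscale_def distrib_left)
next
  case (2 a b x) then show ?case by (intro ext) (simp add: vscale_def distrib_right)
next
  case (3 a b x) then show ?case by (intro ext) (simp only: vscale_def mult.assoc)
next
  case (4 x) then show ?case by (intro ext) (simp add: vscale_def)
qed

text \<open>Bounding degrees from below, instead of asking for homogeneity, spares the splitting of
  Koszul chains into homogeneous components.\<close>

definition ord_ge :: "nat \<Rightarrow> ('n::finite, 'k::field) poly_ring \<Rightarrow> bool" where
  "ord_ge g p \<longleftrightarrow> (\<forall>t\<in>keys p. g \<le> mdeg t)"

text \<open>The sign of moving \<open>e_i\<close> into its sorted position in the wedge product over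
  \<open>insert i \<sigma>\<close>.\<close>

definition ksign :: "'n::linorder \<Rightarrow> 'n set \<Rightarrow> 'k::field" where
  "ksign i \<sigma> = (- 1) ^ card {k\<in>\<sigma>. k < i}"

text \<open>
  A Koszul chain \<open>z\<close> assigns to a set \<open>\<sigma>\<close> of variables the coefficient of the basis element
  \<open>e\<^sub>\<sigma>\<close>, a vector over the polynomial ring.
\<close>

definition kdiff :: "('n::{finite,linorder} set \<Rightarrow> nat \<Rightarrow> ('n, 'k::field) poly_ring) \<Rightarrow>
    'n set \<Rightarrow> nat \<Rightarrow> ('n, 'k) poly_ring" where
  "kdiff z \<sigma> = (\<lambda>j. \<Sum>i\<in>-\<sigma>. Poly_Mapping.single (mvar i) (ksign i \<sigma>) * z (insert i \<sigma>) j)"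

definition kchain :: "nat \<Rightarrow> (nat \<Rightarrow> ('n, 'k::field) poly_ring) set \<Rightarrow>
    ('n::{finite,linorder} set \<Rightarrow> nat \<Rightarrow> ('n, 'k) poly_ring) set" where
  "kchain i M = {z. \<forall>\<sigma>. z \<sigma> \<in> M \<and> (card \<sigma> \<noteq> i \<longrightarrow> z \<sigma> = 0)}"

section \<open>Koszul signs and the square of the Koszul differential\<close>

lemma ksign_mult_self [simp]: "ksign i \<sigma> * ksign i \<sigma> = (1 :: 'k::field)"
  by (simp add: ksign_def flip: power_mult_distrib)

lemma ksign_insert:
  "j \<notin> \<sigma> \<Longrightarrow> ksign i (insert j \<sigma>) = (if j < i then - ksign i \<sigma> else ksign i \<sigma> :: 'k::field)"
  for i :: "'n::{finite,linorder}"
proof -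
  assume "j \<notin> \<sigma>"
  have "{k \<in> insert j \<sigma>. k < i} = (if j < i then insert j {k \<in> \<sigma>. k < i} else {k \<in> \<sigma>. k < i})"
    by auto
  then show ?thesis using \<open>j \<notin> \<sigma>\<close> by (simp add: ksign_def)
qed

text \<open>The larger of \<open>i\<close> and \<open>j\<close> has its sign flipped by the prior
  insertion of the other; the sign of the smaller one stays.\<close>

lemma ksign_swap:
  fixes i j :: "'n::{finite,linorder}"
  assumes "i \<noteq> j" "i \<notin> \<sigma>" "j \<notin> \<sigma>"
  shows "ksign i \<sigma> * ksign j (insert i \<sigma>) = - (ksign j \<sigma> * ksign i (insert j \<sigma>) :: 'k::field)"
  using assms by (cases "i < j") (auto simp: ksign_insert)

lemma kdiff_add: "kdiff (y + z) = kdiff y + kdiff z"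
  by (simp add: kdiff_def fun_eq_iff algebra_simps sum.distrib)

lemma kdiff_minus: "kdiff (y - z) = kdiff y - kdiff z"
  by (simp add: kdiff_def fun_eq_iff algebra_simps sum_subtractf)

lemma kdiff_eq_sum: "kdiff z \<sigma> = (\<Sum>i\<in>-\<sigma>. vscale (Poly_Mapping.single (mvar i) (ksign i \<sigma>)) (z (insert i \<sigma>)))"
  by (rule ext) (simp add: kdiff_def sum_fun_apply vscale_def)

lemma kdiff_kdiff: "kdiff (kdiff z) = 0"
  for z :: "'n::{finite,linorder} set \<Rightarrow> nat \<Rightarrow> ('n, 'k::field) poly_ring"
proof (intro ext)
  fix \<sigma> :: "'n set" and j
  \<comment> \<open>\<open>f a b\<close> is the contribution of the ordered pair of variables added
    to \<open>\<sigma>\<close>. It is antisymmetric, so the pairs with \<open>a < b\<close> cancel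
    those with \<open>b < a\<close>.\<close>
  define f where "f a b = Poly_Mapping.single (mvar a + mvar b) (ksign a \<sigma> * ksign b (insert a \<sigma>))
      * z (insert a (insert b \<sigma>)) j" for a b
  have f_swap: "f b a = - f a b" if "a \<noteq> b" "a \<notin> \<sigma>" "b \<notin> \<sigma>" for a b
    using ksign_swap[of b a \<sigma>, where 'k = 'k] that
    by (simp add: f_def add.commute[of "mvar b"] insert_commute[of b] single_uminus)
  have "kdiff (kdiff z) \<sigma> j = (\<Sum>a\<in>-\<sigma>. \<Sum>b\<in>-\<sigma>-{a}. f a b)"
    unfolding kdiff_def f_def sum_distrib_left
    by (intro sum.cong) (auto simp: mult_single insert_commute mult.assoc[symmetric])
  also have "\<dots> = (\<Sum>(a,b)\<in>(SIGMA a:-\<sigma>. -\<sigma>-{a}). f a b)"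
    by (rule sum.Sigma) auto
  also have "(SIGMA a:-\<sigma>. -\<sigma>-{a}) = {(a,b). a \<notin> \<sigma> \<and> b \<notin> \<sigma> \<and> a < b} \<union> {(a,b). a \<notin> \<sigma> \<and> b \<notin> \<sigma> \<and> b < a}"
    by auto
  also have "(\<Sum>(a,b)\<in>\<dots>. f a b) = (\<Sum>(a,b)\<in>{(a,b). a \<notin> \<sigma> \<and> b \<notin> \<sigma> \<and> a < b}. f a b)
      + (\<Sum>(a,b)\<in>{(a,b). a \<notin> \<sigma> \<and> b \<notin> \<sigma> \<and> b < a}. f a b)"
    by (rule sum.union_disjoint) auto
  also have "(\<Sum>(a,b)\<in>{(a,b). a \<notin> \<sigma> \<and> b \<notin> \<sigma> \<and> b < a}. f a b)
      = (\<Sum>(a,b)\<in>{(a,b). a \<notin> \<sigma> \<and> b \<notin> \<sigma> \<and> a < b}. f b a)"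
    by (rule sum.reindex_bij_witness[of _ prod.swap prod.swap]) auto
  also have "\<dots> = (\<Sum>(a,b)\<in>{(a,b). a \<notin> \<sigma> \<and> b \<notin> \<sigma> \<and> a < b}. - f a b)"
    by (rule sum.cong) (auto intro!: f_swap)
  finally show "kdiff (kdiff z) \<sigma> j = 0 \<sigma> j"
    by (simp add: case_prod_unfold sum_negf)
qed

lemma lookup_kdiff:
  "lookup (kdiff z \<sigma> j) s =
     (\<Sum>i | i \<notin> \<sigma> \<and> 0 < lookup s i. ksign i \<sigma> * lookup (z (insert i \<sigma>) j) (s - mvar i))"
proof -
  have "lookup (kdiff z \<sigma> j) s = (\<Sum>i\<in>-\<sigma>. if 0 < lookup s i then ksign i \<sigma> * lookup (z (insert i \<sigma>) j) (s - mvar i) else 0)"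
    by (simp add: kdiff_def lookup_sum lookup_single_mult mdvd_mvar_iff)
  also have "\<dots> = (\<Sum>i\<in>{i \<in> -\<sigma>. 0 < lookup s i}. ksign i \<sigma> * lookup (z (insert i \<sigma>) j) (s - mvar i))"
    by (rule sum.inter_filter[symmetric]) simp
  finally show ?thesis by simp
qed

text \<open>
  A contracting homotopy of the Koszul complex modulo the variables in \<open>V\<close>: in each multidegree,
  i.e. for a fixed value of \<open>s + \<sigma>\<close>, the complex of \<open>S\<close> is the chain complex of a simplex, and the
  homotopy is the cone over the vertex chosen by \<open>Min\<close>.
\<close>

definition free_vars :: "'n set \<Rightarrow> 'n set \<Rightarrow> 'n pmonom \<Rightarrow> 'n set" where
  "free_vars V \<sigma> s = {i. i \<notin> V \<and> (i \<in> \<sigma> \<or> 0 < lookup s i)}"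

definition khom_coeff :: "'n set \<Rightarrow> ('n::{finite,linorder} set \<Rightarrow> nat \<Rightarrow> ('n, 'k::field) poly_ring) \<Rightarrow>
    'n set \<Rightarrow> nat \<Rightarrow> 'n pmonom \<Rightarrow> 'k" where
  "khom_coeff V a \<sigma> j s =
     (let l = Min (free_vars V \<sigma> s) in
      if free_vars V \<sigma> s \<noteq> {} \<and> l \<in> \<sigma> then ksign l (\<sigma> - {l}) * lookup (a (\<sigma> - {l}) j) (s + mvar l) else 0)"

definition khom :: "'n set \<Rightarrow> ('n::{finite,linorder} set \<Rightarrow> nat \<Rightarrow> ('n, 'k::field) poly_ring) \<Rightarrow>
    'n set \<Rightarrow> nat \<Rightarrow> ('n, 'k) poly_ring" where
  "khom V a \<sigma> j = Abs_poly_mapping (khom_coeff V a \<sigma> j)"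

lemma khom_coeff_nonzeroD:
  assumes "khom_coeff V a \<sigma> j s \<noteq> 0"
  obtains l where "l \<in> \<sigma>" "l \<notin> V" "s + mvar l \<in> keys (a (\<sigma> - {l}) j)"
proof (rule that)
  let ?l = "Min (free_vars V \<sigma> s)"
  have ne: "free_vars V \<sigma> s \<noteq> {}" and "?l \<in> \<sigma>" and "lookup (a (\<sigma> - {?l}) j) (s + mvar ?l) \<noteq> 0"
    using assms by (auto simp: khom_coeff_def Let_def split: if_splits)
  then show "?l \<in> \<sigma>" "s + mvar ?l \<in> keys (a (\<sigma> - {?l}) j)"
    by (auto simp: in_keys_iff)
  show "?l \<notin> V"
    using Min_in[OF finite ne] by (simp add: free_vars_def)
qed

text \<open>The support is finite because each nonzero coefficient arises from a term of
  \<open>a\<close> by cancelling one of finitely many variables.\<close>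

lemma lookup_khom [simp]: "lookup (khom V a \<sigma> j) = khom_coeff V a \<sigma> j"
proof -
  have "{s. khom_coeff V a \<sigma> j s \<noteq> 0} \<subseteq> (\<Union>l. (\<lambda>s. s + mvar l) -` keys (a (\<sigma> - {l}) j))"
    by (blast elim: khom_coeff_nonzeroD)
  moreover have "finite (\<Union>l. (\<lambda>s. s + mvar l) -` keys (a (\<sigma> - {l}) j))"
    by (intro finite_UN_I finite_vimageI) (auto simp: inj_on_def)
  ultimately have "finite {s. khom_coeff V a \<sigma> j s \<noteq> 0}"
    by (rule finite_subset)
  then show ?thesis unfolding khom_def by (rule lookup_Abs_poly_mapping)
qed

text \<open>Moving \<open>x_i\<close> from the monomial to the basis element keeps the multidegree,
  so \<open>Min\<close> selects the same vertex before and after the differential.\<close>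

lemma free_vars_insert: "i \<notin> \<sigma> \<Longrightarrow> 0 < lookup s i \<Longrightarrow> free_vars V (insert i \<sigma>) (s - mvar i) = free_vars V \<sigma> s"
  by (auto simp: free_vars_def lookup_minus lookup_single when_def)

text \<open>The cone identity dh + hd = id for the vertex \<open>l\<close>. If \<open>l\<close> is
  not in \<open>\<sigma>\<close>, then hd vanishes and only the summand \<open>i = l\<close> of dh
  remains. Otherwise the summand of hd that puts \<open>l\<close> back yields \<open>a\<close>, and
  the other summands cancel against dh.\<close>

lemma lookup_kdiff_khom:
  fixes a :: "'n::{finite,linorder} set \<Rightarrow> nat \<Rightarrow> ('n, 'k::field) poly_ring"
  assumes ne: "free_vars V \<sigma> s \<noteq> {}"
  shows "lookup (kdiff (khom V a) \<sigma> j) s + lookup (khom V (kdiff a) \<sigma> j) s = lookup (a \<sigma> j) s"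
proof -
  define l where "l = Min (free_vars V \<sigma> s)"
  have l: "l \<in> \<sigma> \<or> 0 < lookup s l"
    using Min_in[OF finite ne] by (simp add: free_vars_def l_def)
  define A where "A = {i. i \<notin> \<sigma> \<and> 0 < lookup s i}"
  have khom_A: "khom_coeff V a (insert i \<sigma>) j (s - mvar i) = (if l \<in> insert i \<sigma> then
      ksign l (insert i \<sigma> - {l}) * lookup (a (insert i \<sigma> - {l}) j) (s - mvar i + mvar l) else 0)" if "i \<in> A" for i
    using that ne by (simp add: A_def khom_coeff_def free_vars_insert Let_def l_def)
  have "lookup (kdiff (khom V a) \<sigma> j) s = (\<Sum>i\<in>A. ksign i \<sigma> * khom_coeff V a (insert i \<sigma>) j (s - mvar i))"
    by (simp add: lookup_kdiff A_def)
  then have lhs1: "lookup (kdiff (khom V a) \<sigma> j) s = (\<Sum>i\<in>A. ksign i \<sigma> * (if l \<in> insert i \<sigma> then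
      ksign l (insert i \<sigma> - {l}) * lookup (a (insert i \<sigma> - {l}) j) (s - mvar i + mvar l) else 0))"
    using khom_A by simp
  show ?thesis
  proof (cases "l \<in> \<sigma>")
    case False
    then have "l \<in> A" using l by (simp add: A_def)
    have "lookup (kdiff (khom V a) \<sigma> j) s = (\<Sum>i\<in>A. if i = l then lookup (a \<sigma> j) s else 0)"
      unfolding lhs1 using False
      by (intro sum.cong) (auto simp: A_def minus_mvar_add mult.assoc[symmetric])
    also have "\<dots> = lookup (a \<sigma> j) s" using \<open>l \<in> A\<close> by simp
    finally show ?thesis using False by (simp add: khom_coeff_def l_def Let_def)
  next
    case True
    define \<tau> where "\<tau> = \<sigma> - {l}"
    have \<sigma>: "\<sigma> = insert l \<tau>" "l \<notin> \<tau>" using True by (auto simp: \<tau>_def)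
    \<comment> \<open>Multiplying by \<open>x_l\<close> makes \<open>l\<close> itself eligible in
      the sum for \<open>kdiff a \<tau>\<close>; this adds the one summand that returns
      \<open>a \<sigma>\<close>.\<close>
    have "{i. i \<notin> \<tau> \<and> 0 < lookup (s + mvar l) i} = insert l A"
      by (auto simp: \<tau>_def A_def lookup_add lookup_single when_def)
    moreover have "l \<notin> A" using True by (simp add: A_def)
    ultimately have "lookup (kdiff a \<tau> j) (s + mvar l) = ksign l \<tau> * lookup (a \<sigma> j) s
        + (\<Sum>i\<in>A. ksign i \<tau> * lookup (a (insert i \<tau>) j) (s + mvar l - mvar i))"
      by (simp add: lookup_kdiff \<sigma>(1)[symmetric])
    moreover have "lookup (khom V (kdiff a) \<sigma> j) s = ksign l \<tau> * lookup (kdiff a \<tau> j) (s + mvar l)"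
      using True ne by (simp add: khom_coeff_def l_def Let_def \<tau>_def)
    ultimately have "lookup (khom V (kdiff a) \<sigma> j) s = lookup (a \<sigma> j) s
        + (\<Sum>i\<in>A. ksign l \<tau> * ksign i \<tau> * lookup (a (insert i \<tau>) j) (s + mvar l - mvar i))"
      by (simp add: distrib_left sum_distrib_left mult.assoc[symmetric])
    moreover have "lookup (kdiff (khom V a) \<sigma> j) s =
        (\<Sum>i\<in>A. - (ksign l \<tau> * ksign i \<tau> * lookup (a (insert i \<tau>) j) (s + mvar l - mvar i)))"
      unfolding lhs1
    proof (rule sum.cong[OF refl])
      fix i assume "i \<in> A"
      then have i: "i \<notin> \<tau>" "i \<noteq> l" "0 < lookup s i" using True by (auto simp: A_def \<tau>_def)
      then have "insert i \<sigma> - {l} = insert i \<tau>" using \<sigma> by auto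
      moreover have "s - mvar i + mvar l = s + mvar l - mvar i"
        using i by (intro poly_mapping_eqI) (auto simp: lookup_add lookup_minus lookup_single when_def)
      moreover have "ksign i \<sigma> * ksign l (insert i \<tau>) = - (ksign l \<tau> * ksign i \<tau> :: 'k)"
        unfolding \<sigma>(1) using ksign_insert[of l \<tau> i, where 'k = 'k] ksign_insert[of i \<tau> l, where 'k = 'k] i \<sigma>(2)
        by (cases "i < l") auto
      ultimately show "ksign i \<sigma> * (if l \<in> insert i \<sigma> then
          ksign l (insert i \<sigma> - {l}) * lookup (a (insert i \<sigma> - {l}) j) (s - mvar i + mvar l) else 0)
        = - (ksign l \<tau> * ksign i \<tau> * lookup (a (insert i \<tau>) j) (s + mvar l - mvar i))"
        using True by (simp add: mult.assoc[symmetric])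
    qed
    ultimately show ?thesis by (simp add: sum_negf)
  qed
qed

section \<open>Orders of Koszul chains and acyclicity of the Koszul complex\<close>

lemma ord_ge_zero [simp]: "ord_ge g 0"
  by (simp add: ord_ge_def)

lemma ord_ge_add: "ord_ge g p \<Longrightarrow> ord_ge g q \<Longrightarrow> ord_ge g (p + q)"
  using keys_add[of p q] by (auto simp: ord_ge_def)

lemma ord_ge_uminus: "ord_ge g p \<Longrightarrow> ord_ge g (- p)"
  by (simp add: ord_ge_def in_keys_iff)

lemma ord_ge_minus: "ord_ge g p \<Longrightarrow> ord_ge g q \<Longrightarrow> ord_ge g (p - q)"
  using ord_ge_add[of g p "- q"] ord_ge_uminus[of g q] by simp

lemma ord_ge_sum: "(\<And>i. i \<in> A \<Longrightarrow> ord_ge g (f i)) \<Longrightarrow> ord_ge g (sum f A)"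
  by (induction A rule: infinite_finite_induct) (auto intro: ord_ge_add)

lemma ord_ge_mult: "ord_ge g p \<Longrightarrow> ord_ge h q \<Longrightarrow> ord_ge (g + h) (p * q)"
  unfolding ord_ge_def using keys_mult[of p q] by (fastforce simp: mdeg_add intro: add_mono)

lemma ord_ge_mono: "ord_ge h p \<Longrightarrow> g \<le> h \<Longrightarrow> ord_ge g p"
  by (auto simp: ord_ge_def)

lemma ord_ge_0 [simp]: "ord_ge 0 p"
  by (simp add: ord_ge_def)

lemma ord_ge_kdiff:
  assumes "\<And>\<sigma>. ord_ge g (z \<sigma> j)"
  shows "ord_ge (Suc g) (kdiff z \<sigma> j)"
proof -
  have "ord_ge 1 (Poly_Mapping.single (mvar i) c)" for i :: 'a and c :: 'b
    by (simp add: ord_ge_def)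
  then show ?thesis
    unfolding kdiff_def using assms by (intro ord_ge_sum) (metis ord_ge_mult plus_1_eq_Suc)
qed

lemma kchainD: "z \<in> kchain i M \<Longrightarrow> z \<sigma> \<in> M" "z \<in> kchain i M \<Longrightarrow> card \<sigma> \<noteq> i \<Longrightarrow> z \<sigma> = 0"
  by (auto simp: kchain_def)

lemma kchain_add: "y \<in> kchain i M \<Longrightarrow> z \<in> kchain i M \<Longrightarrow> vec.subspace M \<Longrightarrow> y + z \<in> kchain i M"
  by (simp add: kchain_def vec.subspace_add)

lemma kchain_kdiff:
  assumes "z \<in> kchain (Suc i) M" "vec.subspace M"
  shows "kdiff z \<in> kchain i M"
proof -
  have "z (insert a \<sigma>) = 0" if "card \<sigma> \<noteq> i" "a \<notin> \<sigma>" for a \<sigma>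
    using that by (intro kchainD(2)[OF assms(1)]) simp
  then have "kdiff z \<sigma> = 0" if "card \<sigma> \<noteq> i" for \<sigma>
    using that unfolding kdiff_eq_sum by (intro sum.neutral) simp
  moreover have "kdiff z \<sigma> \<in> M" for \<sigma>
    unfolding kdiff_eq_sum using assms
    by (intro vec.subspace_sum vec.subspace_scale) (auto simp: kchain_def)
  ultimately show ?thesis by (simp add: kchain_def)
qed

lemma kdiff_kchain_0: "z \<in> kchain 0 M \<Longrightarrow> kdiff z = 0"
  by (intro ext) (auto simp: kdiff_def kchain_def intro!: sum.neutral)

text \<open>The witness is \<open>khom V a\<close>. In a multidegree with a free variable the
  difference is \<open>khom V (kdiff a)\<close>, whose terms arise from terms of the ideal by
  cancelling a variable outside \<open>V\<close> and so stay in the ideal. Without a free variable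
  the monomial is nonconstant, by the order bound, and involves only variables of
  \<open>V\<close>.\<close>

lemma koszul_exact_mod_variables:
  fixes a :: "'n::{finite,linorder} set \<Rightarrow> nat \<Rightarrow> ('n, 'k::field) poly_ring"
  assumes a: "a \<in> kchain i (free_module q)"
    and ord: "\<And>\<sigma> j. ord_ge (Suc g) (a \<sigma> j)"
    and da: "\<And>\<sigma> j. kdiff a \<sigma> j \<in> monomial_ideal (mvar ` V)"
  obtains b where "b \<in> kchain (Suc i) (free_module q)" "\<And>\<sigma> j. ord_ge g (b \<sigma> j)"
    "\<And>\<sigma> j. a \<sigma> j - kdiff b \<sigma> j \<in> monomial_ideal (mvar ` V)"
proof (rule that)
  show "khom V a \<in> kchain (Suc i) (free_module q)"
  proof -
    have "khom V a \<sigma> j = 0" if "card \<sigma> \<noteq> Suc i \<or> q \<le> j" for \<sigma> j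
    proof (rule ccontr)
      assume "khom V a \<sigma> j \<noteq> 0"
      then obtain s where "khom_coeff V a \<sigma> j s \<noteq> 0"
        by (metis lookup_khom lookup_zero poly_mapping_eqI)
      then obtain l where l: "l \<in> \<sigma>" "s + mvar l \<in> keys (a (\<sigma> - {l}) j)"
        by (rule khom_coeff_nonzeroD)
      then have "a (\<sigma> - {l}) j \<noteq> 0" by auto
      moreover have "a (\<sigma> - {l}) \<in> free_module q" "card (\<sigma> - {l}) \<noteq> i \<Longrightarrow> a (\<sigma> - {l}) = 0"
        using a by (auto simp: kchain_def)
      ultimately have "card (\<sigma> - {l}) = i" "j < q"
        by (metis zero_fun_apply, auto simp: free_module_def not_le[symmetric])
      then show False using that l(1) by (metis card.remove finite not_le)
    qed
    then show ?thesis by (auto simp: kchain_def free_module_def fun_eq_iff)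
  qed
  show "ord_ge g (khom V a \<sigma> j)" for \<sigma> j
    unfolding ord_ge_def
  proof
    fix s assume "s \<in> keys (khom V a \<sigma> j)"
    then have "khom_coeff V a \<sigma> j s \<noteq> 0" by (simp add: in_keys_iff)
    then obtain l where l: "s + mvar l \<in> keys (a (\<sigma> - {l}) j)"
      by (rule khom_coeff_nonzeroD)
    with ord[of "\<sigma> - {l}" j] have "Suc g \<le> mdeg (s + mvar l)" by (auto simp: ord_ge_def)
    then show "g \<le> mdeg s" by (simp add: mdeg_add)
  qed
  show "a \<sigma> j - kdiff (khom V a) \<sigma> j \<in> monomial_ideal (mvar ` V)" for \<sigma> j
    unfolding monomial_ideal_iff
  proof
    fix s assume s: "s \<in> keys (a \<sigma> j - kdiff (khom V a) \<sigma> j)"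
    show "\<exists>m\<in>mvar ` V. mdvd m s"
    proof (cases "free_vars V \<sigma> s = {}")
      case False
      then have "khom_coeff V (kdiff a) \<sigma> j s \<noteq> 0"
        using lookup_kdiff_khom[OF False, of a j] s by (auto simp: in_keys_iff lookup_minus)
      then obtain l where l: "l \<notin> V" "s + mvar l \<in> keys (kdiff a (\<sigma> - {l}) j)"
        by (rule khom_coeff_nonzeroD)
      then obtain v where v: "v \<in> V" "mdvd (mvar v) (s + mvar l)"
        using da by (fastforce simp: monomial_ideal_iff)
      then have "0 < lookup s v"
        using l(1) by (auto simp: mdvd_mvar_iff lookup_add lookup_single when_def split: if_splits)
      then show ?thesis using v(1) by (auto simp: mdvd_mvar_iff)
    next
      case True
      then have "free_vars V (insert i \<sigma>) (s - mvar i) = {}" if "i \<notin> \<sigma>" "0 < lookup s i" for i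
        using that by (simp add: free_vars_insert)
      then have "lookup (kdiff (khom V a) \<sigma> j) s = 0"
        by (simp add: lookup_kdiff khom_coeff_def)
      then have "s \<in> keys (a \<sigma> j)" using s by (simp add: in_keys_iff lookup_minus)
      then have "Suc g \<le> mdeg s" using ord by (auto simp: ord_ge_def)
      then have "s \<noteq> 0" using mdeg_eq_0_iff[of s] by auto
      then obtain i where "0 < lookup s i" by (metis gr0I lookup_zero poly_mapping_eqI)
      then have "i \<in> V" using True by (auto simp: free_vars_def)
      then show ?thesis using \<open>0 < lookup s i\<close> by (auto simp: mdvd_mvar_iff)
    qed
  qed
qed

text \<open>The case \<open>V = {}\<close>, in which the ideal is zero: acyclicity of the Koszul
  complex of a free module for cycles without constant terms, with control of the order.\<close>

lemma koszul_exact: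
  fixes a :: "'n::{finite,linorder} set \<Rightarrow> nat \<Rightarrow> ('n, 'k::field) poly_ring"
  assumes "a \<in> kchain i (free_module q)" "\<And>\<sigma> j. ord_ge (Suc g) (a \<sigma> j)" "kdiff a = 0"
  obtains b where "b \<in> kchain (Suc i) (free_module q)" "\<And>\<sigma> j. ord_ge g (b \<sigma> j)" "kdiff b = a"
proof -
  obtain b where b: "b \<in> kchain (Suc i) (free_module q)" "\<And>\<sigma> j. ord_ge g (b \<sigma> j)"
    "\<And>\<sigma> j. a \<sigma> j - kdiff b \<sigma> j \<in> monomial_ideal (mvar ` {})"
    using koszul_exact_mod_variables[of a i q g "{}"] assms
    by (auto simp: monomial_ideal_iff)
  have "kdiff b = a"
  proof (intro ext)
    fix \<sigma> j
    have "keys (a \<sigma> j - kdiff b \<sigma> j) = {}" using b(3)[of \<sigma> j] by (auto simp: monomial_ideal_iff)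
    then show "kdiff b \<sigma> j = a \<sigma> j" by simp
  qed
  then show thesis using b that by blast
qed

text \<open>All basis vectors count as degree 0 here. The shifts \<open>d + i\<close> of a linear
  resolution then show up only as the degree of the matrix: \<open>d\<close> for the augmentation
  and 1 for the later maps.\<close>

definition homog_matrix :: "nat \<Rightarrow> nat \<Rightarrow> nat \<Rightarrow> (nat \<Rightarrow> nat \<Rightarrow> ('n::finite, 'k::field) poly_ring) \<Rightarrow> bool" where
  "homog_matrix g q r A \<longleftrightarrow> (\<forall>j<q. \<forall>l<r. homogeneous (int g) (A j l))"

text \<open>
  The Koszul homology \<open>H\<^sub>i(x; M)\<close> is concentrated in internal degree \<open>g\<close>, for a module \<open>M\<close> living in
  degrees \<open>\<ge> g\<close>.
\<close>

definition klin :: "nat \<Rightarrow> nat \<Rightarrow> (nat \<Rightarrow> ('n::{finite,linorder}, 'k::field) poly_ring) set \<Rightarrow> bool" where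
  "klin i g M \<longleftrightarrow> (\<forall>z\<in>kchain i M. kdiff z = 0 \<longrightarrow> (\<forall>\<sigma> j. ord_ge (Suc g) (z \<sigma> j)) \<longrightarrow>
     (\<exists>y\<in>kchain (Suc i) M. kdiff y = z))"

lemma klinD:
  assumes "klin i g M" "z \<in> kchain i M" "kdiff z = 0" "\<And>\<sigma> j. ord_ge (Suc g) (z \<sigma> j)"
  obtains y where "y \<in> kchain (Suc i) M" "kdiff y = z"
  using assms by (auto simp: klin_def)

section \<open>Maps of free modules and dimension shifting for Koszul homology\<close>

lemma mat_map_hom: "module_hom vscale vscale (mat_map q r A)"
proof (unfold_locales, goal_cases)
  case (1 b c)
  show ?case by (auto simp: mat_map_def fun_eq_iff distrib_left sum.distrib)
next
  case (2 f b)
  show ?case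
    unfolding mat_map_def vscale_def fun_eq_iff
    by (auto simp: sum_distrib_left mult.left_commute[of f] intro!: sum.cong)
qed

lemmas mat_map_0 = module_hom.zero[OF mat_map_hom]
lemmas mat_map_diff = module_hom.diff[OF mat_map_hom]
lemmas mat_map_add = module_hom.add[OF mat_map_hom]

lemma kdiff_mat_map: "kdiff (\<lambda>\<sigma>. mat_map q r A (y \<sigma>)) = (\<lambda>\<sigma>. mat_map q r A (kdiff y \<sigma>))"
  unfolding kdiff_eq_sum module_hom.sum[OF mat_map_hom] module_hom.scale[OF mat_map_hom] ..

lemma subspace_free_module: "vec.subspace (free_module r)"
  by (rule vec.subspaceI) (auto simp: free_module_def vscale_def)

abbreviation mat_image where "mat_image q r A \<equiv> mat_map q r A ` free_module r"
abbreviation mat_kernel where "mat_kernel q r A \<equiv> {c \<in> free_module r. mat_map q r A c = (\<lambda>_. 0)}"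

lemma mat_kernel_altdef: "mat_kernel q r A = {c \<in> free_module r. mat_map q r A c = 0}"
  by (simp add: zero_fun_def)

lemma subspace_mat_image: "vec.subspace (mat_image q r A)"
  by (rule module_hom.subspace_image[OF mat_map_hom subspace_free_module])

lemma subspace_mat_kernel: "vec.subspace (mat_kernel q r A)"
  unfolding mat_kernel_altdef
  using subspace_free_module[of r] unfolding vec.subspace_def
  by (auto simp: mat_map_0 mat_map_add module_hom.scale[OF mat_map_hom])

lemma homogeneous_imp_ord_ge: "homogeneous (int g) p \<Longrightarrow> ord_ge g p"
  by (auto simp: homogeneous_def ord_ge_def)

lemma ord_ge_mat_map:
  assumes "homog_matrix g q r A" "\<And>l. ord_ge h (c l)"
  shows "ord_ge (g + h) (mat_map q r A c j)"
  using assms unfolding mat_map_def homog_matrix_def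
  by (auto intro!: ord_ge_sum ord_ge_mult intro: homogeneous_imp_ord_ge)

lemma ord_ge_homogeneous_eq_0:
  "ord_ge g p \<Longrightarrow> homogeneous (int h) p \<Longrightarrow> h < g \<Longrightarrow> p = 0"
  unfolding keys_eq_empty[symmetric] ord_ge_def homogeneous_def by fastforce

lemma homogeneous_mult: "homogeneous g p \<Longrightarrow> homogeneous h q \<Longrightarrow> homogeneous (g + h) (p * q)"
  unfolding homogeneous_def using keys_mult[of p q] by (fastforce simp: mdeg_add)

lemma homogeneous_add: "homogeneous g p \<Longrightarrow> homogeneous g q \<Longrightarrow> homogeneous g (p + q)"
  unfolding homogeneous_def using keys_add[of p q] by blast

lemma homogeneous_sum: "(\<And>i. i \<in> A \<Longrightarrow> homogeneous g (f i)) \<Longrightarrow> homogeneous g (sum f A)"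
  by (induction A rule: infinite_finite_induct) (auto intro: homogeneous_add simp: homogeneous_def[of _ 0])

lemma homogeneous_mat_map:
  assumes "homog_matrix g q r A" "\<And>l. homogeneous (int h) (c l)"
  shows "homogeneous (int (g + h)) (mat_map q r A c j)"
proof -
  have "homogeneous (int g + int h) (mat_map q r A c j)"
    using assms unfolding mat_map_def homog_matrix_def
    by (auto intro!: homogeneous_sum homogeneous_mult simp: homogeneous_def[of _ 0])
  then show ?thesis by simp
qed

definition part :: "'n pmonom set \<Rightarrow> ('n, 'k::field) poly_ring \<Rightarrow> ('n, 'k) poly_ring" where
  "part T p = Poly_Mapping.mapp (\<lambda>t c. if t \<in> T then c else 0) p"

lemma lookup_part: "lookup (part T p) t = (if t \<in> T then lookup p t else 0)"
  by (simp add: part_def lookup_mapp when_def in_keys_iff)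

lemma keys_part: "keys (part T p) = keys p \<inter> T"
  by (auto simp: in_keys_iff lookup_part split: if_splits)

lemma part_0 [simp]: "part T 0 = 0"
  by (intro poly_mapping_eqI) (simp add: lookup_part)

lemma part_Compl: "part T p + part (- T) p = p"
  by (intro poly_mapping_eqI) (simp add: lookup_part lookup_add)

lemma part_superset: "keys p \<subseteq> T \<Longrightarrow> part T p = p"
  by (intro poly_mapping_eqI) (auto simp: lookup_part in_keys_iff)

definition hcomp :: "nat \<Rightarrow> (nat \<Rightarrow> ('n::finite, 'k::field) poly_ring) \<Rightarrow> nat \<Rightarrow> ('n, 'k) poly_ring" where
  "hcomp n x = (\<lambda>j. part {t. mdeg t = n} (x j))"

lemma homogeneous_hcomp: "homogeneous (int n) (hcomp n x j)"
  by (simp add: hcomp_def homogeneous_def keys_part)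

text \<open>The constant terms of a preimage contribute exactly the degree \<open>g\<close> part of
  \<open>x\<close>, which is zero; they can therefore be dropped.\<close>

lemma mat_image_ord_lift:
  assumes A: "homog_matrix g q r A" and x: "x \<in> mat_image q r A" "\<And>j. ord_ge (Suc g) (x j)"
  obtains c where "c \<in> free_module r" "\<And>l. ord_ge 1 (c l)" "mat_map q r A c = x"
proof -
  obtain c where c: "c \<in> free_module r" "x = mat_map q r A c" using x(1) by blast
  define c' where "c' = (\<lambda>l. part (- {t. mdeg t = 0}) (c l))"
  have c': "ord_ge 1 (c' l)" for l
    by (auto simp: c'_def ord_ge_def keys_part)
  have split: "c = hcomp 0 c + c'"
    by (simp add: fun_eq_iff hcomp_def c'_def part_Compl)
  then have "mat_map q r A (hcomp 0 c) = x - mat_map q r A c'"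
    using c(2) mat_map_add[of q r A "hcomp 0 c" c'] by simp
  moreover have "ord_ge (Suc g) (mat_map q r A c' j)" for j
    using ord_ge_mat_map[OF A, of 1 c' j] c' by (simp add: Suc_eq_plus1)
  ultimately have "ord_ge (Suc g) (mat_map q r A (hcomp 0 c) j)" for j
    using x(2) by (simp add: ord_ge_minus)
  moreover have "homogeneous (int g) (mat_map q r A (hcomp 0 c) j)" for j
    using homogeneous_mat_map[OF A, of 0 "hcomp 0 c" j] homogeneous_hcomp[of 0 c] by simp
  ultimately have "mat_map q r A (hcomp 0 c) = 0"
    by (auto simp: fun_eq_iff intro: ord_ge_homogeneous_eq_0)
  then have "mat_map q r A c' = x"
    using c(2) split mat_map_add[of q r A "hcomp 0 c" c'] by simp
  moreover have "c' \<in> free_module r" using c(1) by (simp add: free_module_def c'_def)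
  ultimately show thesis using c' that by blast
qed

lemma kchain_lift:
  assumes z: "z \<in> kchain i M" and "Q 0"
    and "\<And>\<sigma>. \<exists>c\<in>free_module r. Q c \<and> mat_map q r A c = z \<sigma>"
  obtains y where "y \<in> kchain i (free_module r)" "\<And>\<sigma>. Q (y \<sigma>)" "z = (\<lambda>\<sigma>. mat_map q r A (y \<sigma>))"
proof -
  obtain f where f: "\<And>\<sigma>. f \<sigma> \<in> free_module r \<and> Q (f \<sigma>) \<and> mat_map q r A (f \<sigma>) = z \<sigma>"
    using assms(3) by metis
  \<comment> \<open>The preimage chosen for the zero vector may be nonzero, so the choice is
    replaced by 0 on sets of the wrong size.\<close>
  define y where "y \<sigma> = (if card \<sigma> = i then f \<sigma> else 0)" for \<sigma>
  have "y \<in> kchain i (free_module r)" "\<And>\<sigma>. Q (y \<sigma>)"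
    using f \<open>Q 0\<close> vec.subspace_0[OF subspace_free_module] by (auto simp: y_def kchain_def)
  moreover have "z = (\<lambda>\<sigma>. mat_map q r A (y \<sigma>))"
    using f kchainD(2)[OF z] by (auto simp: y_def mat_map_0 fun_eq_iff)
  ultimately show thesis by (rule that)
qed

text \<open>The chain lifts to the free module without constant terms and bounds there; the bounding
  chain is then mapped back into the image.\<close>

lemma klin_0_mat_image:
  fixes A :: "nat \<Rightarrow> nat \<Rightarrow> ('n::{finite,linorder}, 'k::field) poly_ring"
  assumes A: "homog_matrix g q r A"
  shows "klin 0 g (mat_image q r A)"
  unfolding klin_def
proof (intro ballI impI)
  fix z assume z: "z \<in> kchain 0 (mat_image q r A)" "\<forall>\<sigma> j. ord_ge (Suc g) (z \<sigma> j)"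
  have "\<exists>c\<in>free_module r. (\<forall>l. ord_ge 1 (c l)) \<and> mat_map q r A c = z \<sigma>" for \<sigma>
    using mat_image_ord_lift[OF A kchainD(1)[OF z(1), of \<sigma>]] z(2) by metis
  then obtain y where y: "y \<in> kchain 0 (free_module r)" "\<And>\<sigma>. \<forall>l. ord_ge 1 (y \<sigma> l)"
    "z = (\<lambda>\<sigma>. mat_map q r A (y \<sigma>))"
    using kchain_lift[OF z(1), of "\<lambda>c. \<forall>l. ord_ge 1 (c l)" r q A] by auto
  obtain w where w: "w \<in> kchain 1 (free_module r)" "kdiff w = y"
    using koszul_exact[of y 0 r 0] y(1,2) kdiff_kchain_0[OF y(1)] by (auto simp: One_nat_def)
  show "\<exists>y\<in>kchain (Suc 0) (mat_image q r A). kdiff y = z"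
  proof (intro bexI)
    show "kdiff (\<lambda>\<sigma>. mat_map q r A (w \<sigma>)) = z"
      by (simp add: kdiff_mat_map w(2) y(3))
    show "(\<lambda>\<sigma>. mat_map q r A (w \<sigma>)) \<in> kchain (Suc 0) (mat_image q r A)"
      using w(1) by (auto simp: kchain_def mat_map_0 One_nat_def)
  qed
qed

text \<open>Dimension shift along 0 \<rightarrow> kernel \<rightarrow> free module \<rightarrow>
  image \<rightarrow> 0. A cycle in the kernel bounds some \<open>y\<close> in the free module. The
  image of \<open>y\<close> is a cycle, hence the boundary of some \<open>u\<close>, and subtracting
  the boundary of a lift of \<open>u\<close> moves \<open>y\<close> into the kernel.\<close>

lemma klin_mat_kernel:
  fixes A :: "nat \<Rightarrow> nat \<Rightarrow> ('n::{finite,linorder}, 'k::field) poly_ring"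
  assumes A: "homog_matrix g q r A" and lin: "klin (Suc i) g (mat_image q r A)"
  shows "klin i 1 (mat_kernel q r A)"
  unfolding klin_def mat_kernel_altdef
proof (intro ballI impI)
  let ?N = "{c \<in> free_module r. mat_map q r A c = 0}"
  fix z assume z: "z \<in> kchain i ?N" "kdiff z = 0" "\<forall>\<sigma> j. ord_ge (Suc 1) (z \<sigma> j)"
  have "z \<in> kchain i (free_module r)" using z(1) by (auto simp: kchain_def)
  then obtain y where y: "y \<in> kchain (Suc i) (free_module r)" "\<And>\<sigma> j. ord_ge 1 (y \<sigma> j)" "kdiff y = z"
    using koszul_exact[of z i r 1] z(2,3) by blast
  define w where "w = (\<lambda>\<sigma>. mat_map q r A (y \<sigma>))"
  have w: "w \<in> kchain (Suc i) (mat_image q r A)"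
    using y(1) by (auto simp: kchain_def mat_map_0 w_def)
  have "kdiff w = 0"
    using z(1) by (auto simp: w_def kdiff_mat_map y(3) kchain_def fun_eq_iff)
  moreover have "ord_ge (Suc g) (w \<sigma> j)" for \<sigma> j
    using ord_ge_mat_map[OF A, of 1 "y \<sigma>" j] y(2) by (simp add: w_def Suc_eq_plus1)
  ultimately obtain u where u: "u \<in> kchain (Suc (Suc i)) (mat_image q r A)" "kdiff u = w"
    using klinD[OF lin w] by blast
  obtain v where v: "v \<in> kchain (Suc (Suc i)) (free_module r)" "u = (\<lambda>\<sigma>. mat_map q r A (v \<sigma>))"
  proof (rule kchain_lift[OF u(1), of "\<lambda>_. True" r q A])
    show "\<exists>c\<in>free_module r. True \<and> mat_map q r A c = u \<sigma>" for \<sigma>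
      using kchainD(1)[OF u(1), of \<sigma>] by auto
  qed auto
  have dv: "kdiff v \<in> kchain (Suc i) (free_module r)"
    by (rule kchain_kdiff[OF v(1) subspace_free_module])
  have "mat_map q r A ((y - kdiff v) \<sigma>) = 0" for \<sigma>
    using u(2) by (simp add: mat_map_diff v(2) kdiff_mat_map w_def fun_eq_iff)
  moreover have "(y - kdiff v) \<sigma> \<in> free_module r" for \<sigma>
    using vec.subspace_diff[OF subspace_free_module kchainD(1)[OF y(1)] kchainD(1)[OF dv]] by simp
  ultimately have "y - kdiff v \<in> kchain (Suc i) ?N"
    using kchainD(2)[OF y(1)] kchainD(2)[OF dv] by (simp add: kchain_def)
  moreover have "kdiff (y - kdiff v) = z"
    by (simp add: kdiff_minus kdiff_kdiff y(3))
  ultimately show "\<exists>y\<in>kchain (Suc i) ?N. kdiff y = z" by blast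
qed

text \<open>The converse shift. A lift \<open>y\<close> of the cycle has its boundary in the kernel,
  where it bounds some \<open>u\<close>; then \<open>y - u\<close> is a cycle of the free module and
  bounds there. The hypothesis \<open>ker\<close> ensures that \<open>y - u\<close> has no constant
  terms, as acyclicity requires.\<close>

lemma klin_mat_image:
  fixes A :: "nat \<Rightarrow> nat \<Rightarrow> ('n::{finite,linorder}, 'k::field) poly_ring"
  assumes A: "homog_matrix g q r A" and lin: "klin i 1 (mat_kernel q r A)"
    and ker: "\<And>c l. c \<in> mat_kernel q r A \<Longrightarrow> ord_ge 1 (c l)"
  shows "klin (Suc i) g (mat_image q r A)"
  unfolding klin_def
proof (intro ballI impI)
  fix z assume z: "z \<in> kchain (Suc i) (mat_image q r A)" "kdiff z = 0" "\<forall>\<sigma> j. ord_ge (Suc g) (z \<sigma> j)"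
  have "\<exists>c\<in>free_module r. (\<forall>l. ord_ge 1 (c l)) \<and> mat_map q r A c = z \<sigma>" for \<sigma>
    using mat_image_ord_lift[OF A kchainD(1)[OF z(1), of \<sigma>]] z(3) by metis
  then obtain y where y: "y \<in> kchain (Suc i) (free_module r)" "\<And>\<sigma>. \<forall>l. ord_ge 1 (y \<sigma> l)"
    "z = (\<lambda>\<sigma>. mat_map q r A (y \<sigma>))"
    using kchain_lift[OF z(1), of "\<lambda>c. \<forall>l. ord_ge 1 (c l)" r q A] by auto
  have dy: "kdiff y \<in> kchain i (free_module r)"
    by (rule kchain_kdiff[OF y(1) subspace_free_module])
  have "mat_map q r A (kdiff y \<sigma>) = (\<lambda>_. 0)" for \<sigma>
    using z(2) unfolding y(3) kdiff_mat_map by (simp add: fun_eq_iff)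
  then have ky: "kdiff y \<in> kchain i (mat_kernel q r A)"
    using dy by (auto simp: kchain_def)
  have "ord_ge (Suc 1) (kdiff y \<sigma> j)" for \<sigma> j
    using y(2) by (intro ord_ge_kdiff) blast
  then obtain u where u: "u \<in> kchain (Suc i) (mat_kernel q r A)" "kdiff u = kdiff y"
    using klinD[OF lin ky kdiff_kdiff] by blast
  have yu: "y - u \<in> kchain (Suc i) (free_module r)"
    using y(1) u(1) by (auto simp: kchain_def intro!: vec.subspace_diff[OF subspace_free_module])
  have ord: "ord_ge (Suc 0) ((y - u) \<sigma> j)" for \<sigma> j
    using y(2) ker[OF kchainD(1)[OF u(1)]] by (auto simp: One_nat_def intro!: ord_ge_minus)
  have "kdiff (y - u) = 0" by (simp add: kdiff_minus u(2))
  then obtain v where v: "v \<in> kchain (Suc (Suc i)) (free_module r)" "kdiff v = y - u"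
    by (rule koszul_exact[OF yu ord])
  have "mat_map q r A (u \<sigma>) = 0" for \<sigma>
    using kchainD(1)[OF u(1), of \<sigma>] by (auto simp: zero_fun_def)
  then have "kdiff (\<lambda>\<sigma>. mat_map q r A (v \<sigma>)) = z"
    by (simp add: kdiff_mat_map v(2) y(3) mat_map_diff)
  moreover have "(\<lambda>\<sigma>. mat_map q r A (v \<sigma>)) \<in> kchain (Suc (Suc i)) (mat_image q r A)"
    using v(1) by (auto simp: kchain_def mat_map_0)
  ultimately show "\<exists>y\<in>kchain (Suc (Suc i)) (mat_image q r A). kdiff y = z" by blast
qed

section \<open>Linear resolutions and Koszul homology\<close>

definition graded :: "(nat \<Rightarrow> ('n::finite, 'k::field) poly_ring) set \<Rightarrow> bool" where
  "graded M \<longleftrightarrow> (\<forall>x\<in>M. \<forall>n. hcomp n x \<in> M)"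

definition degree_part :: "nat \<Rightarrow> (nat \<Rightarrow> ('n::finite, 'k::field) poly_ring) set \<Rightarrow>
    (nat \<Rightarrow> ('n, 'k) poly_ring) set" where
  "degree_part g M = {x \<in> M. \<forall>j. homogeneous (int g) (x j)}"

lemma part_mono_mult:
  fixes p :: "('n::finite, 'k::field) poly_ring"
  shows "part {t. mdeg t = Suc n} (Poly_Mapping.single (mvar i) c * p) =
    Poly_Mapping.single (mvar i) c * part {t. mdeg t = n} p"
proof (rule poly_mapping_eqI)
  fix t :: "'n pmonom"
  show "lookup (part {t. mdeg t = Suc n} (Poly_Mapping.single (mvar i) c * p)) t =
    lookup (Poly_Mapping.single (mvar i) c * part {t. mdeg t = n} p) t"
  proof (cases "0 < lookup t i")
    case True
    then have "mdeg t = Suc (mdeg (t - mvar i))"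
      using mdeg_add[of "t - mvar i" "mvar i"] by (simp add: minus_mvar_add)
    then show ?thesis by (simp add: lookup_part lookup_single_mult)
  qed (simp add: lookup_part lookup_single_mult mdvd_mvar_iff)
qed

text \<open>Nakayama's argument by induction on the degree. Above degree \<open>g\<close>, an
  element seen as a 0-chain bounds, so it is a combination of elements of \<open>M\<close> with the
  variables, up to sign, as coefficients; their components one degree lower are covered by
  induction.\<close>

lemma homogeneous_generated:
  fixes M :: "(nat \<Rightarrow> ('n::{finite,linorder}, 'k::field) poly_ring) set"
  assumes sub: "vec.subspace M" and gr: "graded M" and ord: "\<And>x j. x \<in> M \<Longrightarrow> ord_ge g (x j)"
    and lin: "klin 0 g M"
  shows "x \<in> degree_part n M \<Longrightarrow> x \<in> vec.span (degree_part g M)"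
proof (induction n arbitrary: x)
  case 0
  show ?case
  proof (cases "g = 0")
    case False
    then have "x = 0"
      using 0 ord by (auto simp: degree_part_def fun_eq_iff intro!: ord_ge_homogeneous_eq_0[of g _ 0])
    then show ?thesis using vec.span_zero by (simp only:)
  qed (use 0 in \<open>auto intro: vec.span_base\<close>)
next
  case (Suc n)
  have x: "x \<in> M" "\<And>j. homogeneous (int (Suc n)) (x j)"
    using Suc.prems by (auto simp: degree_part_def)
  consider "Suc n < g" | "Suc n = g" | "g < Suc n" by linarith
  then show ?case
  proof cases
    case 1
    then have "x = 0"
      using x ord by (auto simp: fun_eq_iff intro!: ord_ge_homogeneous_eq_0[of g _ "Suc n"])
    then show ?thesis using vec.span_zero by (simp only:)
  next
    case 2
    then show ?thesis using Suc.prems by (auto intro: vec.span_base)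
  next
    case 3
    define z :: "'n set \<Rightarrow> nat \<Rightarrow> ('n, 'k) poly_ring" where "z \<sigma> = (if \<sigma> = {} then x else 0)" for \<sigma>
    have z: "z \<in> kchain 0 M"
      using x(1) vec.subspace_0[OF sub] by (auto simp: kchain_def z_def)
    have "ord_ge (Suc g) (z \<sigma> j)" for \<sigma> j
      using homogeneous_imp_ord_ge[OF x(2)] 3 by (auto simp: z_def intro: ord_ge_mono[of "Suc n"])
    then obtain y where y: "y \<in> kchain (Suc 0) M" "kdiff y = z"
      using klinD[OF lin z kdiff_kchain_0[OF z]] by blast
    have "x j = (\<Sum>i\<in>UNIV. vscale (Poly_Mapping.single (mvar i) (ksign i {})) (hcomp n (y {i}))) j" for j
    proof -
      have xj: "x j = (\<Sum>i\<in>UNIV. Poly_Mapping.single (mvar i) (ksign i {}) * y {i} j)"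
        using fun_cong[OF fun_cong[OF y(2)], of "{}" j] by (simp add: z_def kdiff_def)
      \<comment> \<open>Only the degree \<open>n\<close> components of the \<open>y {i}\<close>
        reach degree \<open>Suc n\<close>.\<close>
      have "x j = part {t. mdeg t = Suc n} (x j)"
        using x(2)[of j] by (intro part_superset[symmetric]) (auto simp: homogeneous_def)
      also have "\<dots> = part {t. mdeg t = Suc n} (\<Sum>i\<in>UNIV. Poly_Mapping.single (mvar i) (ksign i {}) * y {i} j)"
        by (simp only: xj[symmetric])
      also have "\<dots> =
          (\<Sum>i\<in>UNIV. Poly_Mapping.single (mvar i) (ksign i {}) * part {t. mdeg t = n} (y {i} j))"
        unfolding part_mono_mult[symmetric]
        by (intro poly_mapping_eqI) (simp add: lookup_part lookup_sum)
      finally show ?thesis by (simp add: sum_fun_apply vscale_def hcomp_def)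
    qed
    then have "x = (\<Sum>i\<in>UNIV. vscale (Poly_Mapping.single (mvar i) (ksign i {})) (hcomp n (y {i})))"
      by (rule ext)
    moreover have "hcomp n (y {i}) \<in> degree_part n M" for i
      using gr kchainD(1)[OF y(1)] by (auto simp: graded_def degree_part_def homogeneous_hcomp)
    ultimately show ?thesis
      using Suc.IH by (metis (no_types, lifting) vec.span_scale vec.span_sum)
  qed
qed

lemma sum_hcomp:
  fixes x :: "nat \<Rightarrow> ('n::finite, 'k::field) poly_ring"
  assumes "x \<in> free_module q"
  obtains N where "x = (\<Sum>n\<le>N. hcomp n x)"
proof
  define T where "T = (\<Union>j<q. mdeg ` keys (x j))"
  have "finite T" by (simp add: T_def)
  \<comment> \<open>If \<open>T\<close> is empty then \<open>Max T\<close> is arbitrary, but then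
    \<open>x\<close> and all its components are zero.\<close>
  show "x = (\<Sum>n\<le>Max T. hcomp n x)"
  proof (intro ext poly_mapping_eqI)
    fix j t
    show "lookup (x j) t = lookup ((\<Sum>n\<le>Max T. hcomp n x) j) t"
    proof (cases "lookup (x j) t = 0")
      case False
      then have "j < q" using assms by (auto simp: free_module_def not_le[symmetric])
      then have "mdeg t \<in> T" using False by (auto simp: T_def in_keys_iff intro!: bexI[of _ j] imageI)
      then have "mdeg t \<le> Max T" using \<open>finite T\<close> by simp
      then show ?thesis
        by (simp add: sum_fun_apply hcomp_def lookup_sum lookup_part)
    qed (simp add: sum_fun_apply hcomp_def lookup_sum lookup_part)
  qed
qed

lemma generated_by_degree_part:
  fixes M :: "(nat \<Rightarrow> ('n::{finite,linorder}, 'k::field) poly_ring) set"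
  assumes sub: "vec.subspace M" and gr: "graded M" and ord: "\<And>x j. x \<in> M \<Longrightarrow> ord_ge g (x j)"
    and lin: "klin 0 g M" and M: "M \<subseteq> free_module q"
  shows "M \<subseteq> vec.span (degree_part g M)"
proof
  fix x assume "x \<in> M"
  then obtain N where N: "x = (\<Sum>n\<le>N. hcomp n x)" using M sum_hcomp by blast
  have "hcomp n x \<in> vec.span (degree_part g M)" for n
  proof (rule homogeneous_generated[OF sub gr _ lin])
    show "hcomp n x \<in> degree_part n M"
      using \<open>x \<in> M\<close> gr by (auto simp: graded_def degree_part_def homogeneous_hcomp)
  qed (rule ord)
  then show "x \<in> vec.span (degree_part g M)"
    by (subst N) (rule vec.span_sum)
qed

section \<open>Linear algebra over the field in a fixed degree, and minimal generators\<close>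

definition kscale :: "'k::field \<Rightarrow> (nat \<Rightarrow> ('n, 'k) poly_ring) \<Rightarrow> nat \<Rightarrow> ('n, 'k) poly_ring" where
  "kscale c = vscale (Poly_Mapping.single 0 c)"

interpretation kvec: vector_space kscale
proof (unfold_locales, goal_cases)
  case (1 a x y) then show ?case unfolding kscale_def by (rule vec.scale_right_distrib)
next
  case (2 a b x) then show ?case unfolding kscale_def single_add by (rule vec.scale_left_distrib)
next
  case (3 a b x) then show ?case unfolding kscale_def vec.scale_scale mult_single by simp
next
  case (4 x) then show ?case unfolding kscale_def single_one by (rule vec.scale_one)
qed

lemma lookup_kscale: "lookup (kscale c x j) t = c * lookup (x j) t"
  by (simp add: kscale_def vscale_def lookup_single_mult mdvd_iff)

definition unit_vec :: "nat \<Rightarrow> 'n pmonom \<Rightarrow> nat \<Rightarrow> ('n, 'k::field) poly_ring" where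
  "unit_vec j t = (\<lambda>i. if i = j then mono_poly t else 0)"

text \<open>The finite spanning set bounds the size of independent sets, so a basis of the degree
  \<open>g\<close> part is finite.\<close>

lemma finite_span_degree_part:
  fixes M :: "(nat \<Rightarrow> ('n::finite, 'k::field) poly_ring) set"
  assumes M: "M \<subseteq> free_module q"
  shows "degree_part g M \<subseteq> kvec.span ((\<lambda>(j, t). unit_vec j t) ` ({..<q} \<times> {t. mdeg t = g}))"
    (is "_ \<subseteq> kvec.span (?e ` ?T)")
proof
  fix x assume x: "x \<in> degree_part g M"
  have fin: "finite {t :: 'n pmonom. mdeg t = g}" by (rule finite_mdeg)
  have "x = (\<Sum>p\<in>?T. kscale (lookup (x (fst p)) (snd p)) (?e p))"
  proof (intro ext poly_mapping_eqI)
    fix j and s :: "'n pmonom"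
    have *: "lookup (\<Sum>p\<in>?T. kscale (lookup (x (fst p)) (snd p)) (?e p) j) s
        = (\<Sum>p\<in>?T. if p = (j, s) then lookup (x j) s else 0)"
      unfolding lookup_sum
      by (intro sum.cong) (auto simp: lookup_kscale unit_vec_def mono_poly_def lookup_single when_def split: if_splits)
    also have "\<dots> = (if j < q \<and> mdeg s = g then lookup (x j) s else 0)"
      using fin by (subst sum.delta) auto
    also have "\<dots> = lookup (x j) s"
      using x M by (fastforce simp: degree_part_def homogeneous_def free_module_def in_keys_iff subset_iff not_less)
    finally show "lookup (x j) s = lookup ((\<Sum>p\<in>?T. kscale (lookup (x (fst p)) (snd p)) (?e p)) j) s"
      by (simp add: sum_fun_apply)
  qed
  then show "x \<in> kvec.span (?e ` ?T)"
    by (metis (no_types, lifting) image_eqI kvec.span_base kvec.span_scale kvec.span_sum)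
qed

text \<open>In degree \<open>g\<close> only the constant term of \<open>p\<close> can contribute.
  This turns relations over the ring into relations over the field.\<close>

lemma lookup_homogeneous_mult:
  assumes "homogeneous (int g) q"
  shows "lookup (p * q) s = (if mdeg s = g then lookup p 0 * lookup q s else
    lookup (part (- {t. mdeg t = 0}) p * q) s)"
proof -
  let ?p = "part (- {t. mdeg t = 0}) p"
  have "part {t. mdeg t = 0} p = Poly_Mapping.single 0 (lookup p 0)"
    by (intro poly_mapping_eqI) (auto simp: lookup_part lookup_single when_def mdeg_eq_0_iff)
  then have p: "p = Poly_Mapping.single 0 (lookup p 0) + ?p"
    using part_Compl[of "{t. mdeg t = 0}" p] by simp
  have "lookup (p * q) s = lookup (Poly_Mapping.single 0 (lookup p 0) * q) s + lookup (?p * q) s"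
    by (subst p) (simp only: distrib_right lookup_add)
  also have "lookup (Poly_Mapping.single 0 (lookup p 0) * q) s = lookup p 0 * lookup q s"
    by (simp add: lookup_single_mult mdvd_iff)
  finally have *: "lookup (p * q) s = lookup p 0 * lookup q s + lookup (?p * q) s" .
  show ?thesis
  proof (cases "mdeg s = g")
    case True
    have "ord_ge (1 + g) (?p * q)"
      using assms by (intro ord_ge_mult homogeneous_imp_ord_ge[of g]) (auto simp: ord_ge_def keys_part)
    then have "s \<notin> keys (?p * q)" using True by (auto simp: ord_ge_def)
    then have "lookup (?p * q) s = 0" by (simp add: in_keys_iff)
    then show ?thesis using * True by simp
  next
    case False
    then have "lookup q s = 0" using assms by (auto simp: homogeneous_def in_keys_iff)
    then show ?thesis using * False by simp
  qed
qed

text \<open>The columns are a basis over the field of the degree \<open>g\<close> part, which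
  generates \<open>M\<close>. Nonzero constant terms in a kernel element would give a linear
  relation among the basis vectors.\<close>

lemma exists_generating_matrix:
  fixes M :: "(nat \<Rightarrow> ('n::{finite,linorder}, 'k::field) poly_ring) set"
  assumes sub: "vec.subspace M" and gr: "graded M" and ord: "\<And>x j. x \<in> M \<Longrightarrow> ord_ge g (x j)"
    and lin: "klin 0 g M" and M: "M \<subseteq> free_module q"
  obtains r A where "homog_matrix g q r A" "mat_image q r A = M"
    "\<And>c l. c \<in> mat_kernel q r A \<Longrightarrow> ord_ge 1 (c l)"
proof -
  obtain B where B: "B \<subseteq> degree_part g M" "kvec.independent B" "degree_part g M \<subseteq> kvec.span B"
    using kvec.maximal_independent_subset by blast
  let ?E = "(\<lambda>(j, t). unit_vec j t) ` ({..<q} \<times> {t :: 'n pmonom. mdeg t = g}) :: (nat \<Rightarrow> ('n, 'k) poly_ring) set"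
  have "finite ?E" using finite_mdeg by blast
  moreover have "B \<subseteq> kvec.span ?E" using B(1) finite_span_degree_part[OF M] by blast
  ultimately have "finite B" using kvec.independent_span_bound[OF _ B(2)] by blast
  then obtain bs where bs: "set bs = B" "distinct bs" using finite_distinct_list by blast
  define r where "r = length bs"
  define A where "A j l = (bs ! l) j" for j l
  have nth: "bs ! l \<in> degree_part g M" if "l < r" for l
    using that bs(1) B(1) by (auto simp: r_def)
  then have hom: "homog_matrix g q r A"
    by (auto simp: homog_matrix_def A_def degree_part_def)
  have map_eq: "mat_map q r A c = (\<Sum>l<r. vscale (c l) (bs ! l))" for c
  proof
    fix j
    have "(bs ! l) j = 0" if "l < r" "q \<le> j" for l
      using nth[OF that(1)] M that(2) by (auto simp: degree_part_def free_module_def)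
    then show "mat_map q r A c j = (\<Sum>l<r. vscale (c l) (bs ! l)) j"
      by (auto simp: mat_map_def sum_fun_apply vscale_def A_def mult.commute intro!: sum.cong)
  qed
  have "mat_image q r A = M"
  proof
    show "mat_image q r A \<subseteq> M"
      unfolding map_eq using nth
      by (auto simp: degree_part_def intro!: vec.subspace_sum[OF sub] vec.subspace_scale[OF sub])
    have "B \<subseteq> mat_image q r A"
    proof
      fix b assume "b \<in> B"
      then obtain l where l: "l < r" "b = bs ! l" using bs(1) by (auto simp: r_def in_set_conv_nth)
      define c :: "nat \<Rightarrow> ('n, 'k) poly_ring" where "c = (\<lambda>k. if k = l then 1 else 0)"
      have "mat_map q r A c = (\<Sum>k<r. if k = l then bs ! l else 0)"
        unfolding map_eq c_def by (intro sum.cong) auto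
      also have "\<dots> = b" using l by simp
      finally show "b \<in> mat_image q r A"
        using l(1) by (intro image_eqI[of _ _ c]) (auto simp: c_def free_module_def)
    qed
    then have sp: "vec.span B \<subseteq> mat_image q r A"
      by (rule vec.span_minimal[OF _ subspace_mat_image])
    have "kvec.subspace (vec.span B)"
      by (rule kvec.subspaceI) (auto simp: kscale_def vec.span_zero vec.span_add vec.span_scale)
    then have "kvec.span B \<subseteq> vec.span B"
      by (intro kvec.span_minimal vec.span_superset)
    then have "vec.span (degree_part g M) \<subseteq> vec.span B"
      using B(3) by (intro vec.span_minimal) auto
    then show "M \<subseteq> mat_image q r A"
      using generated_by_degree_part[OF sub gr _ lin M] ord sp by blast
  qed
  moreover have "ord_ge 1 (c l)" if c: "c \<in> mat_kernel q r A" for c l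
  proof (cases "l < r")
    case False
    then have "c l = 0" using c by (auto simp: free_module_def)
    then show ?thesis by simp
  next
    case True
    have inj: "inj_on ((!) bs) {..<r}" using bs(2) by (simp add: inj_on_nth r_def)
    \<comment> \<open>Independence speaks of coefficients indexed by vectors, so positions in
      \<open>bs\<close> are recovered by inverting the indexing.\<close>
    define u where "u b = lookup (c (inv_into {..<r} ((!) bs) b)) 0" for b
    have "(\<Sum>b\<in>B. kscale (u b) b) = (\<Sum>l<r. kscale (lookup (c l) 0) (bs ! l))"
    proof -
      have "B = (!) bs ` {..<r}" using bs(1) by (auto simp: r_def set_conv_nth)
      then have "(\<Sum>b\<in>B. kscale (u b) b) = (\<Sum>l<r. kscale (u (bs ! l)) (bs ! l))"
        using sum.reindex[OF inj] by simp
      also have "\<dots> = (\<Sum>l<r. kscale (lookup (c l) 0) (bs ! l))"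
        using inj by (intro sum.cong) (auto simp: u_def inv_into_f_f)
      finally show ?thesis .
    qed
    also have "\<dots> = 0"
    proof (intro ext poly_mapping_eqI)
      fix j s
      have hom_nth: "homogeneous (int g) ((bs ! l) j)" if "l < r" for l
        using nth[OF that] by (simp add: degree_part_def)
      have "lookup ((\<Sum>l<r. kscale (lookup (c l) 0) (bs ! l)) j) s
          = (\<Sum>l<r. lookup (c l) 0 * lookup ((bs ! l) j) s)"
        by (simp add: sum_fun_apply lookup_sum lookup_kscale)
      also have "\<dots> = 0"
      proof (cases "mdeg s = g")
        case True
        have "(\<Sum>l<r. lookup (c l) 0 * lookup ((bs ! l) j) s) = (\<Sum>l<r. lookup (c l * (bs ! l) j) s)"
          using True by (intro sum.cong) (simp_all add: lookup_homogeneous_mult[OF hom_nth])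
        also have "\<dots> = lookup (mat_map q r A c j) s"
          by (simp add: map_eq sum_fun_apply vscale_def lookup_sum)
        also have "\<dots> = 0" using c by simp
        finally show ?thesis .
      next
        case False
        then have "lookup ((bs ! l) j) s = 0" if "l < r" for l
          using hom_nth[OF that] by (auto simp: homogeneous_def in_keys_iff)
        then show ?thesis by simp
      qed
      finally show "lookup ((\<Sum>l<r. kscale (lookup (c l) 0) (bs ! l)) j) s = lookup (0 j) s"
        by simp
    qed
    finally have "u (bs ! l) = 0"
      using kvec.independentD[OF B(2) \<open>finite B\<close> order_refl, of u "bs ! l"] True bs(1) by (auto simp: r_def)
    then have "lookup (c l) 0 = 0" using inj True by (simp add: u_def inv_into_f_f)
    then have "mdeg t \<noteq> 0" if "t \<in> keys (c l)" for t
      using that by (auto simp: in_keys_iff mdeg_eq_0_iff)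
    then show ?thesis by (force simp: ord_ge_def One_nat_def Suc_le_eq)
  qed
  ultimately show thesis using hom that by blast
qed

lemma irrelevant_idealI: "homogeneous 1 p \<Longrightarrow> p \<in> irrelevant_ideal"
  unfolding irrelevant_ideal_def monomial_ideal_iff
proof (intro ballI)
  fix t assume "homogeneous 1 p" "t \<in> keys p"
  then have "t \<noteq> 0" using mdeg_eq_0_iff[of t] by (auto simp: homogeneous_def)
  then obtain i where "0 < lookup t i" by (metis gr0I lookup_zero poly_mapping_eqI)
  then show "\<exists>m\<in>range mvar. mdvd m t" by (auto simp: mdvd_mvar_iff)
qed

text \<open>The matrix sends the degree \<open>n\<close> component to degree \<open>g + n\<close>
  and the remaining components to other degrees, so the two images cannot cancel each other.\<close>

lemma graded_mat_kernel:
  assumes A: "homog_matrix g q r A"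
  shows "graded (mat_kernel q r A)"
  unfolding graded_def
proof (intro ballI allI)
  fix c n assume c: "c \<in> mat_kernel q r A"
  define c' where "c' = (\<lambda>l. part (- {t. mdeg t = n}) (c l))"
  have "c = hcomp n c + c'"
    by (simp add: fun_eq_iff hcomp_def c'_def part_Compl)
  then have sum0: "mat_map q r A (hcomp n c) + mat_map q r A c' = 0"
    using c mat_map_add[of q r A "hcomp n c" c'] by (simp add: zero_fun_def)
  have "mat_map q r A (hcomp n c) j = 0" for j
  proof (rule poly_mapping_eqI)
    fix s
    have hom: "homogeneous (int (g + n)) (mat_map q r A (hcomp n c) j)"
      by (rule homogeneous_mat_map[OF A]) (rule homogeneous_hcomp)
    have "mdeg t \<noteq> g + n" if "t \<in> keys (mat_map q r A c' j)" for t
    proof -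
      have "j < q" using that by (auto simp: mat_map_def split: if_splits)
      then have "t \<in> keys (\<Sum>l<r. A j l * c' l)" using that by (simp add: mat_map_def)
      then obtain l where "l < r" and t: "t \<in> keys (A j l * c' l)"
        using keys_sum[of "\<lambda>l. A j l * c' l" "{..<r}"] by blast
      obtain a b where "t = a + b" "a \<in> keys (A j l)" "b \<in> keys (c' l)"
        using keys_mult[of "A j l" "c' l"] t by blast
      moreover have "mdeg a = g"
        using A \<open>j < q\<close> \<open>l < r\<close> \<open>a \<in> keys (A j l)\<close> by (auto simp: homog_matrix_def homogeneous_def)
      ultimately show ?thesis by (auto simp: mdeg_add c'_def keys_part)
    qed
    then have "s \<notin> keys (mat_map q r A (hcomp n c) j) \<or> s \<notin> keys (mat_map q r A c' j)"
      using hom unfolding homogeneous_def by (metis of_nat_eq_iff)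
    moreover have "lookup (mat_map q r A (hcomp n c) j) s + lookup (mat_map q r A c' j) s = 0"
      using arg_cong[OF sum0, of "\<lambda>x. lookup (x j) s"] by (simp add: lookup_add)
    ultimately show "lookup (mat_map q r A (hcomp n c) j) s = lookup 0 s"
      by (auto simp: in_keys_iff)
  qed
  moreover have "hcomp n c \<in> free_module r" using c by (auto simp: free_module_def hcomp_def)
  ultimately show "hcomp n c \<in> mat_kernel q r A" by auto
qed

section \<open>Ideals as submodules of the free module of rank one\<close>

definition augmentation :: "(nat \<Rightarrow> ('n, 'k::field) poly_ring) \<Rightarrow> nat \<Rightarrow> nat \<Rightarrow> ('n, 'k) poly_ring" where
  "augmentation \<epsilon> = (\<lambda>j l. \<epsilon> l)"

abbreviation ideal_vecs :: "('n, 'k::field) poly_ring set \<Rightarrow> (nat \<Rightarrow> ('n, 'k) poly_ring) set" where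
  "ideal_vecs I \<equiv> {x \<in> free_module 1. x 0 \<in> I}"

text \<open>The embedding \<open>E\<close> of the ring as coordinate 0 turns the map onto
  \<open>I\<close> into a matrix with one row, so it can be treated like the other maps of the
  resolution.\<close>

lemma augmentation_image:
  "(\<lambda>c. \<Sum>j<r. c j * \<epsilon> j) ` free_module r = I \<longleftrightarrow> mat_image 1 r (augmentation \<epsilon>) = ideal_vecs I"
proof -
  define f where "f c = (\<Sum>j<r. c j * \<epsilon> j)" for c
  define E :: "('a, 'b) poly_ring \<Rightarrow> nat \<Rightarrow> ('a, 'b) poly_ring" where
    "E a = (\<lambda>j. if j = 0 then a else 0)" for a
  have "mat_map 1 r (augmentation \<epsilon>) c = E (f c)" for c
    by (auto simp: mat_map_def augmentation_def f_def E_def mult.commute fun_eq_iff)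
  then have image: "mat_image 1 r (augmentation \<epsilon>) = E ` f ` free_module r"
    by (simp add: image_image)
  have E_0 [simp]: "E a 0 = a" for a by (simp add: E_def)
  have "x = E (x 0)" if "x \<in> free_module 1" for x
    using that by (auto simp: free_module_def E_def fun_eq_iff One_nat_def Suc_le_eq)
  moreover have "E a \<in> free_module 1" for a by (simp add: free_module_def E_def)
  ultimately have "ideal_vecs I = E ` I"
    by auto
  moreover have "inj E" by (metis E_0 injI)
  ultimately show ?thesis
    unfolding f_def[symmetric] image by (simp add: inj_image_eq_iff)
qed

lemma augmentation_kernel:
  "{c \<in> free_module r. (\<Sum>j<r. c j * \<epsilon> j) = 0} = mat_kernel 1 r (augmentation \<epsilon>)"
  by (auto simp: mat_map_def augmentation_def mult.commute fun_eq_iff)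

text \<open>Induction on the homological degree for all syzygy modules at once: each kernel is the
  image of the next map, so \<open>klin_mat_image\<close> reduces \<open>Suc i\<close> at stage
  \<open>n\<close> to \<open>i\<close> at stage \<open>Suc n\<close>. Kernels have no constant terms
  because the matrices have linear entries.\<close>

lemma linear_resolution_imp_klin:
  fixes I :: "('n::{finite,linorder}, 'k::field) poly_ring set"
  assumes "has_linear_resolution d I"
  shows "klin i d (ideal_vecs I)"
proof -
  obtain r e \<epsilon> D where res: "graded_free_resolution I r e \<epsilon> D" and e: "\<And>i j. j < r i \<Longrightarrow> e i j = int (d + i)"
    using assms by (auto simp: has_linear_resolution_def minimal_graded_free_resolution_def)
  have A0: "homog_matrix d 1 (r 0) (augmentation \<epsilon>)"
    using res e[of _ 0] by (simp add: graded_free_resolution_def homog_matrix_def augmentation_def)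
  have AD: "homog_matrix 1 (r n) (r (Suc n)) (D n)" for n
    unfolding homog_matrix_def
  proof (intro allI impI)
    fix j l assume "j < r n" "l < r (Suc n)"
    moreover from this have "e (Suc n) l - e n j = int 1" by (simp add: e)
    ultimately show "homogeneous (int 1) (D n j l)"
      using res unfolding graded_free_resolution_def by metis
  qed
  have I: "mat_image 1 (r 0) (augmentation \<epsilon>) = ideal_vecs I"
    using res by (simp add: graded_free_resolution_def augmentation_image)
  have K0: "mat_kernel 1 (r 0) (augmentation \<epsilon>) = mat_image (r 0) (r (Suc 0)) (D 0)"
    using res by (simp add: graded_free_resolution_def augmentation_kernel One_nat_def)
  have K: "mat_kernel (r n) (r (Suc n)) (D n) = mat_image (r (Suc n)) (r (Suc (Suc n))) (D (Suc n))" for n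
    using res by (simp add: graded_free_resolution_def)
  have ord: "ord_ge 1 (c l)" if "c \<in> mat_image (r n) (r (Suc n)) (D n)" for n c l
    using that ord_ge_mat_map[OF AD, of 0 _ n l] by auto
  have "klin i 1 (mat_image (r n) (r (Suc n)) (D n))" for i n
  proof (induction i arbitrary: n)
    case 0
    show ?case by (rule klin_0_mat_image[OF AD])
  next
    case (Suc i)
    show ?case
    proof (rule klin_mat_image[OF AD])
      show "klin i 1 (mat_kernel (r n) (r (Suc n)) (D n))" unfolding K by (rule Suc.IH)
      show "ord_ge 1 (c l)" if "c \<in> mat_kernel (r n) (r (Suc n)) (D n)" for c l
        using that unfolding K by (rule ord)
    qed
  qed
  then have 1: "klin i 1 (mat_kernel 1 (r 0) (augmentation \<epsilon>))" for i
    unfolding K0 .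
  have 2: "ord_ge 1 (c l)" if "c \<in> mat_kernel 1 (r 0) (augmentation \<epsilon>)" for c l
    using that unfolding K0 by (rule ord)
  show ?thesis
  proof (cases i)
    case 0
    then show ?thesis using klin_0_mat_image[OF A0] I by simp
  next
    case (Suc k)
    then show ?thesis using klin_mat_image[OF A0 1] 2 unfolding I by blast
  qed
qed

text \<open>The resolution is built one map at a time. Concentration for the current kernel makes it
  generated in degree 1, a matrix of minimal generators covers it, and
  \<open>klin_mat_kernel\<close> passes concentration on to the next kernel.\<close>

lemma klin_imp_linear_resolution:
  fixes I :: "('n::{finite,linorder}, 'k::field) poly_ring set"
  assumes lin: "\<And>i. klin i d (ideal_vecs I)"
    and sub: "vec.subspace (ideal_vecs I)"
    and gr: "graded (ideal_vecs I)"
    and ord: "\<And>p. p \<in> I \<Longrightarrow> ord_ge d p"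
  shows "has_linear_resolution d I"
proof -
  let ?I = "ideal_vecs I"
  have "ord_ge d (x j)" if "x \<in> ?I" for x j
    using that ord by (cases j) (auto simp: free_module_def One_nat_def)
  then obtain r0 A0 where A0: "homog_matrix d 1 r0 A0" "mat_image 1 r0 A0 = ?I"
    "\<And>c l. c \<in> mat_kernel 1 r0 A0 \<Longrightarrow> ord_ge 1 (c l)"
    using exists_generating_matrix[OF sub gr _ lin, of 1] by blast
  define \<epsilon> where "\<epsilon> = A0 0"
  have map0: "mat_map 1 r0 (augmentation \<epsilon>) = mat_map 1 r0 A0"
    by (auto simp: mat_map_def augmentation_def \<epsilon>_def fun_eq_iff)
  \<comment> \<open>\<open>P\<close> is the invariant of a stage; \<open>Q\<close> says that the
    next matrix is linear and maps onto the current kernel.\<close>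
  define P where "P = (\<lambda>(q, r, A :: nat \<Rightarrow> nat \<Rightarrow> ('n, 'k) poly_ring).
    graded (mat_kernel q r A) \<and> (\<forall>i. klin i 1 (mat_kernel q r A)) \<and>
    (\<forall>c\<in>mat_kernel q r A. \<forall>l. ord_ge 1 (c l)))"
  define Q where "Q = (\<lambda>(q, r, A :: nat \<Rightarrow> nat \<Rightarrow> ('n, 'k) poly_ring) (q', r', A').
    q' = r \<and> homog_matrix 1 r r' A' \<and> mat_kernel q r A = mat_image r r' A')"
  have P0: "P (1, r0, A0)"
    unfolding P_def using A0 lin by (auto intro!: graded_mat_kernel[OF A0(1)] klin_mat_kernel[OF A0(1)])
  have step: "\<exists>t. P t \<and> Q s t" if s: "P s" for s
  proof -
    obtain q r A where [simp]: "s = (q, r, A)" by (cases s)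
    obtain r' A' where A': "homog_matrix 1 r r' A'" "mat_image r r' A' = mat_kernel q r A"
      "\<And>c l. c \<in> mat_kernel r r' A' \<Longrightarrow> ord_ge 1 (c l)"
      using exists_generating_matrix[OF subspace_mat_kernel, of r q A 1 r] s unfolding P_def by auto
    have "klin (Suc i) 1 (mat_image r r' A')" for i
      using s unfolding A'(2) P_def by auto
    then have "P (r, r', A')"
      unfolding P_def using A'
      by (auto intro!: graded_mat_kernel[OF A'(1)] klin_mat_kernel[OF A'(1)])
    moreover have "Q s (r, r', A')" using A' by (simp add: Q_def)
    ultimately show ?thesis by blast
  qed
  \<comment> \<open>The clause for \<open>n = 0\<close> pins the sequence to the first matrix;
    dependent choice alone would begin at an arbitrary admissible stage.\<close>
  obtain f where f: "f 0 = (1, r0, A0)" "\<And>n. P (f n)" "\<And>n. Q (f n) (f (Suc n))"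
    using dependent_nat_choice[of "\<lambda>n s. P s \<and> (n = 0 \<longrightarrow> s = (1, r0, A0))" "\<lambda>_. Q"] P0 step
    by (metis nat.simps(3))
  define r where "r n = fst (snd (f n))" for n
  define D where "D n = snd (snd (f (Suc n)))" for n
  have f_Suc: "f (Suc n) = (r n, r (Suc n), D n)" for n
    using f(3)[of n] by (cases "f n"; cases "f (Suc n)") (auto simp: Q_def r_def D_def)
  have r0: "r 0 = r0" by (simp add: r_def f(1))
  have D: "homog_matrix 1 (r n) (r (Suc n)) (D n)" for n
    using f(3)[of n] unfolding f_Suc by (cases "f n") (simp add: Q_def r_def)
  have K0: "mat_kernel 1 (r 0) (augmentation \<epsilon>) = mat_image (r 0) (r 1) (D 0)"
    using f(3)[of 0] unfolding f_Suc f(1) map0 r0 by (simp add: Q_def One_nat_def)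
  have K: "mat_kernel (r n) (r (Suc n)) (D n) = mat_image (r (Suc n)) (r (Suc (Suc n))) (D (Suc n))" for n
    using f(3)[of "Suc n"] unfolding f_Suc by (simp add: Q_def)
  have "graded_free_resolution I r (\<lambda>i _. int (d + i)) \<epsilon> D"
    unfolding graded_free_resolution_def augmentation_kernel augmentation_image
  proof (intro conjI allI impI)
    show "homogeneous (int (d + 0)) (\<epsilon> j)" if "j < r 0" for j
      using A0(1) that by (simp add: homog_matrix_def \<epsilon>_def r0)
    show "homogeneous (int (d + Suc i) - int (d + i)) (D i j l)" if "j < r i" "l < r (Suc i)" for i j l
      using D[of i] that by (simp add: homog_matrix_def)
    show "mat_image 1 (r 0) (augmentation \<epsilon>) = ?I"
      unfolding r0 map0 by (rule A0(2))
  qed (fact K0 K)+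
  moreover have "D i j l \<in> irrelevant_ideal" if "j < r i" "l < r (Suc i)" for i j l
    using D[of i] that by (intro irrelevant_idealI) (simp add: homog_matrix_def)
  ultimately show ?thesis
    unfolding has_linear_resolution_def minimal_graded_free_resolution_def by blast
qed

lemma monomial_ideal_mono: "T \<subseteq> T' \<Longrightarrow> monomial_ideal T \<subseteq> monomial_ideal T'"
  by (rule subsetI) (simp add: monomial_ideal_iff, blast)

lemma subspace_ideal_vecs:
  assumes "ring_mod.subspace I"
  shows "vec.subspace (ideal_vecs I)"
  using assms by (auto simp: vec.subspace_def ring_mod.subspace_def free_module_def vscale_def)

lemma graded_ideal_vecs: "graded (ideal_vecs (monomial_ideal T))"
  by (auto simp: graded_def hcomp_def free_module_def monomial_ideal_iff keys_part)

lemma ord_ge_monomial_ideal: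
  assumes "\<And>t. t \<in> T \<Longrightarrow> mdeg t = d" "p \<in> monomial_ideal T"
  shows "ord_ge d p"
  using assms by (fastforce simp: ord_ge_def monomial_ideal_iff mdvd_def mdeg_add)

section \<open>Linear quotients\<close>

text \<open>Terms not divisible by \<open>m\<close> disappear and the others are divided by
  \<open>m\<close>.\<close>

definition quot :: "'n pmonom \<Rightarrow> ('n, 'k::field) poly_ring \<Rightarrow> ('n, 'k) poly_ring" where
  "quot m p = Poly_Mapping.map_key ((+) m) p"

lemma lookup_quot: "lookup (quot m p) s = lookup p (m + s)"
  by (simp add: quot_def map_key.rep_eq)

lemma lookup_mono_poly_quot: "lookup (mono_poly m * quot m p) t = (if mdvd m t then lookup p t else 0)"
proof -
  have "m + (t - m) = t" if "mdvd m t" using that by (auto simp: mdvd_def)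
  then show ?thesis by (simp add: mono_poly_def lookup_single_mult lookup_quot)
qed

lemma kdiff_vscale: "kdiff (\<lambda>\<sigma>. vscale f (x \<sigma>)) = (\<lambda>\<sigma>. vscale f (kdiff x \<sigma>))"
  by (rule ext) (simp only: kdiff_eq_sum vec.scale_sum_right vec.scale_left_commute[of f])

text \<open>Write a cycle as z = m a + b, where the terms of b are not multiples of m and so lie in
  the ideal of \<open>T\<close>. Then dz = 0 puts da into the colon ideal, and exactness modulo
  variables gives c with a - dc in the colon ideal. Hence z - d(m c) has coefficients in the ideal
  of \<open>T\<close>, where it bounds by assumption.\<close>

lemma klin_insert:
  fixes T :: "'n::{finite,linorder} pmonom set"
  assumes lin: "klin i (mdeg m) (ideal_vecs (monomial_ideal T :: ('n, 'k::field) poly_ring set))"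
    and colon: "colon (monomial_ideal T) (mono_poly m :: ('n, 'k) poly_ring) = monomial_ideal (mvar ` V)"
  shows "klin i (mdeg m) (ideal_vecs (monomial_ideal (insert m T) :: ('n, 'k) poly_ring set))"
  unfolding klin_def
proof (intro ballI impI)
  let ?J = "monomial_ideal T :: ('n, 'k) poly_ring set"
  let ?J' = "monomial_ideal (insert m T) :: ('n, 'k) poly_ring set"
  let ?m = "mono_poly m :: ('n, 'k) poly_ring"
  fix z assume z: "z \<in> kchain i (ideal_vecs ?J')" "kdiff z = 0" "\<forall>\<sigma> j. ord_ge (Suc (mdeg m)) (z \<sigma> j)"
  have subJ: "vec.subspace (ideal_vecs ?J)"
    by (rule subspace_ideal_vecs[OF subspace_monomial_ideal])
  define a where "a \<sigma> = (\<lambda>j. quot m (z \<sigma> j))" for \<sigma>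
  define b where "b \<sigma> = z \<sigma> - vscale ?m (a \<sigma>)" for \<sigma>
  have quot_0: "quot m 0 = (0 :: ('n, 'k) poly_ring)"
    by (intro poly_mapping_eqI) (simp add: lookup_quot)
  have z_1: "z \<sigma> j = 0" if "0 < j" for \<sigma> j
    using kchainD(1)[OF z(1), of \<sigma>] that by (auto simp: free_module_def One_nat_def)
  have a: "a \<in> kchain i (free_module 1)"
    using z(1) by (auto simp: kchain_def a_def free_module_def quot_0 fun_eq_iff)
  have a_ord: "ord_ge (Suc 0) (a \<sigma> j)" for \<sigma> j
    unfolding ord_ge_def
  proof
    fix s assume "s \<in> keys (a \<sigma> j)"
    then have "m + s \<in> keys (z \<sigma> j)" by (simp add: a_def in_keys_iff lookup_quot)
    then have "Suc (mdeg m) \<le> mdeg (m + s)" using z(3) by (auto simp: ord_ge_def)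
    then show "Suc 0 \<le> mdeg s" by (simp add: mdeg_add)
  qed
  have b: "b \<in> kchain i (ideal_vecs ?J)"
  proof -
    have "b \<sigma> 0 \<in> ?J" for \<sigma>
      unfolding monomial_ideal_iff
    proof
      fix t assume "t \<in> keys (b \<sigma> 0)"
      then have "\<not> mdvd m t" "t \<in> keys (z \<sigma> 0)"
        by (auto simp: b_def vscale_def a_def in_keys_iff lookup_minus lookup_mono_poly_quot split: if_splits)
      moreover have "z \<sigma> 0 \<in> ?J'" using z(1) by (auto simp: kchain_def)
      ultimately show "\<exists>m\<in>T. mdvd m t" by (auto simp: monomial_ideal_iff)
    qed
    moreover have "b \<sigma> \<in> free_module 1" for \<sigma>
      using z_1 by (auto simp: free_module_def b_def vscale_def a_def quot_0 One_nat_def)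
    moreover have "b \<sigma> = 0" if "card \<sigma> \<noteq> i" for \<sigma>
      using kchainD(2)[OF z(1) that] kchainD(2)[OF a that] by (simp add: b_def)
    ultimately show ?thesis by (simp add: kchain_def)
  qed
  have z_eq: "z = (\<lambda>\<sigma>. vscale ?m (a \<sigma>)) + b"
    by (simp add: b_def fun_eq_iff)
  have da: "kdiff a \<sigma> j \<in> monomial_ideal (mvar ` V)" for \<sigma> j
  proof (cases "j = 0")
    case True
    have "kdiff (\<lambda>\<sigma>. vscale ?m (a \<sigma>)) + kdiff b = 0"
      using z(2) by (simp only: z_eq kdiff_add)
    then have "vscale ?m (kdiff a \<sigma>) + kdiff b \<sigma> = 0"
      unfolding kdiff_vscale by (metis plus_fun_apply zero_fun_apply)
    then have "vscale ?m (kdiff a \<sigma>) = - kdiff b \<sigma>"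
      by (simp add: eq_neg_iff_add_eq_0)
    also have "- kdiff b \<sigma> \<in> ideal_vecs ?J"
    proof (rule vec.subspace_neg[OF subJ])
      show "kdiff b \<sigma> \<in> ideal_vecs ?J"
        unfolding kdiff_eq_sum using kchainD(1)[OF b]
        by (intro vec.subspace_sum[OF subJ] vec.subspace_scale[OF subJ]) 
    qed
    finally have "?m * kdiff a \<sigma> 0 \<in> ?J" by (simp add: vscale_def)
    then have "kdiff a \<sigma> 0 \<in> colon ?J ?m" by (simp add: colon_def mult.commute)
    then show ?thesis using True by (simp only: colon)
  next
    case False
    then have "kdiff a \<sigma> j = 0" by (simp add: kdiff_def a_def z_1 quot_0)
    then show ?thesis by (simp add: monomial_ideal_iff)
  qed
  obtain c where c: "c \<in> kchain (Suc i) (free_module 1)"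
    "\<forall>\<sigma> j. a \<sigma> j - kdiff c \<sigma> j \<in> monomial_ideal (mvar ` V)"
    by (rule koszul_exact_mod_variables[OF a a_ord da]) simp
  define mc where "mc = (\<lambda>\<sigma>. vscale ?m (c \<sigma>))"
  have dmc: "kdiff mc = (\<lambda>\<sigma>. vscale ?m (kdiff c \<sigma>))"
    unfolding mc_def by (rule kdiff_vscale)
  define w where "w = z - kdiff mc"
  have dc: "kdiff c \<in> kchain i (free_module 1)"
    by (rule kchain_kdiff[OF c(1) subspace_free_module])
  have w_eq: "w \<sigma> = vscale ?m (a \<sigma> - kdiff c \<sigma>) + b \<sigma>" for \<sigma>
    by (simp add: w_def dmc z_eq vec.scale_right_diff_distrib)
  have w: "w \<in> kchain i (ideal_vecs ?J)"
  proof -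
    have "vscale ?m (a \<sigma> - kdiff c \<sigma>) \<in> ideal_vecs ?J" for \<sigma>
    proof -
      have "a \<sigma> 0 - kdiff c \<sigma> 0 \<in> colon ?J ?m" unfolding colon using c(2) by blast
      moreover have "a \<sigma> - kdiff c \<sigma> \<in> free_module 1"
        by (rule vec.subspace_diff[OF subspace_free_module kchainD(1)[OF a] kchainD(1)[OF dc]])
      ultimately show ?thesis by (simp add: colon_def vscale_def free_module_def mult.commute)
    qed
    moreover have "w \<sigma> = 0" if "card \<sigma> \<noteq> i" for \<sigma>
      unfolding w_eq using kchainD(2)[OF a that] kchainD(2)[OF dc that] kchainD(2)[OF b that] by simp
    ultimately show ?thesis
      using kchainD(1)[OF b] vec.subspace_add[OF subJ] unfolding kchain_def w_eq by blast
  qed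
  have dw: "kdiff w = 0" by (simp add: w_def kdiff_minus kdiff_kdiff z(2))
  have w_ord: "ord_ge (Suc (mdeg m)) (w \<sigma> j)" for \<sigma> j
  proof -
    \<comment> \<open>The differential contributes a variable to each term, so subtracting m dc
      keeps the order above \<open>mdeg m\<close>.\<close>
    have "ord_ge (mdeg m + Suc 0) (?m * kdiff c \<sigma> j)"
      by (intro ord_ge_mult ord_ge_kdiff) (simp_all add: ord_ge_def mono_poly_def)
    then show ?thesis using z(3) by (simp add: w_def dmc vscale_def ord_ge_minus)
  qed
  obtain y where y: "y \<in> kchain (Suc i) (ideal_vecs ?J)" "kdiff y = w"
    by (rule klinD[OF lin w dw w_ord])
  have "mc \<sigma> \<in> ideal_vecs ?J'" for \<sigma>
  proof -
    have "?m * p \<in> ?J'" for p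
      by (auto simp: monomial_ideal_iff mono_poly_def in_keys_iff lookup_single_mult)
    then show ?thesis using c(1) by (auto simp: mc_def vscale_def kchain_def free_module_def)
  qed
  moreover have "ideal_vecs ?J \<subseteq> ideal_vecs ?J'"
    using monomial_ideal_mono[of T "insert m T"] by blast
  ultimately have "y \<in> kchain (Suc i) (ideal_vecs ?J')" "mc \<in> kchain (Suc i) (ideal_vecs ?J')"
    using y(1) kchainD(2)[OF c(1)] unfolding kchain_def mc_def by (blast, simp)
  then have "y + mc \<in> kchain (Suc i) (ideal_vecs ?J')"
    by (rule kchain_add[OF _ _ subspace_ideal_vecs[OF subspace_monomial_ideal]])
  moreover have "kdiff (y + mc) = z" by (simp add: kdiff_add y(2) w_def)
  ultimately show "\<exists>y\<in>kchain (Suc i) (ideal_vecs ?J'). kdiff y = z" by blast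
qed

section \<open>From linear quotients to linear resolutions\<close>

lemma klin_zero_ideal:
  "klin i d (ideal_vecs (monomial_ideal {} :: ('n::{finite,linorder}, 'k::field) poly_ring set))"
proof -
  have "ideal_vecs (monomial_ideal {} :: ('n, 'k) poly_ring set) = {0}"
    by (auto simp: monomial_ideal_iff free_module_def fun_eq_iff One_nat_def) (metis gr0I Suc_leI)
  moreover have "kchain i {0} = {0 :: 'n set \<Rightarrow> nat \<Rightarrow> ('n, 'k) poly_ring}" for i
    by (auto simp: kchain_def fun_eq_iff)
  moreover have "kdiff 0 = (0 :: 'n set \<Rightarrow> nat \<Rightarrow> ('n, 'k) poly_ring)"
    by (simp add: kdiff_def fun_eq_iff)
  ultimately show ?thesis by (simp add: klin_def)
qed

text \<open>Monomials are not zero divisors. Written with the empty set of variables, this lets the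
  induction over generators start from the zero ideal.\<close>

lemma colon_zero_ideal: "colon (monomial_ideal {}) (mono_poly m) = monomial_ideal (mvar ` {})"
proof -
  have "g = 0" if "g * mono_poly m = 0" for g :: "('a, 'b) poly_ring"
  proof (rule poly_mapping_eqI)
    fix s
    have "lookup (mono_poly m * g) (m + s) = 0" using that by (simp add: mult.commute)
    then show "lookup g s = lookup 0 s"
      by (simp add: mono_poly_def lookup_single_mult mdvd_iff lookup_add)
  qed
  then show ?thesis by (auto simp: colon_def monomial_ideal_iff)
qed

text \<open>Each \<open>t\<close> in \<open>L\<close> is a multiple of some \<open>m\<close> in
  \<open>G\<close>, itself a multiple of some \<open>s\<close> in \<open>L\<close>; equal degrees
  force \<open>s = m = t\<close>. Hence \<open>L\<close> lies in \<open>G\<close>, and minimality of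
  \<open>G\<close> excludes a proper inclusion.\<close>

lemma minimal_generators_equal:
  fixes L :: "'n::finite pmonom set"
  assumes L: "\<And>t. t \<in> L \<Longrightarrow> mdeg t = d"
    and "minimal_monomial_generating_set (monomial_ideal L :: ('n, 'k::field) poly_ring set) G"
  shows "G = L"
proof -
  have "(monomial_ideal L :: ('n, 'k) poly_ring set) = monomial_ideal G"
    and min: "\<And>G'. G' \<subset> G \<Longrightarrow> (monomial_ideal L :: ('n, 'k) poly_ring set) \<noteq> monomial_ideal G'"
    using assms(2) unfolding minimal_monomial_generating_set_def by blast+
  then have eq: "(\<exists>m\<in>L. mdvd m t) \<longleftrightarrow> (\<exists>m\<in>G. mdvd m t)" for t
    by (simp add: monomial_ideal_eq_iff)
  have "L \<subseteq> G"
  proof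
    fix t assume t: "t \<in> L"
    then obtain m where m: "m \<in> G" "mdvd m t" using eq mdvd_refl[of t] by blast
    then obtain s where s: "s \<in> L" "mdvd s m" using eq mdvd_refl[of m] by blast
    then have "s = t" using mdvd_mdeg_eq[OF mdvd_trans[OF s(2) m(2)]] L t by simp
    then have "m = t" using s(2) m(2) by (intro mdvd_antisym) simp_all
    then show "t \<in> G" using m(1) by simp
  qed
  then show ?thesis using min by blast
qed

text \<open>Concentration of Koszul homology is carried along the prefixes of the ordering by
  \<open>klin_insert\<close>, starting from the zero ideal.\<close>

theorem linear_quotients_imp_linear_resolution:
  fixes L :: "'n::{finite,linorder} pmonom set"
  assumes L: "\<And>t. t \<in> L \<Longrightarrow> mdeg t = d"
    and lq: "has_linear_quotients (monomial_ideal L :: ('n, 'k::field) poly_ring set)"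
  shows "has_linear_resolution d (monomial_ideal L :: ('n, 'k) poly_ring set)"
proof -
  obtain us where "minimal_monomial_generating_set (monomial_ideal L :: ('n, 'k) poly_ring set) (set us)"
    and us: "\<And>j. 1 \<le> j \<Longrightarrow> j < length us \<Longrightarrow>
      \<exists>V. colon (monomial_ideal (set (take j us))) (mono_poly (us ! j) :: ('n, 'k) poly_ring) = monomial_ideal (mvar ` V)"
    using lq unfolding has_linear_quotients_def by blast
  then have set_us: "set us = L" using minimal_generators_equal[OF L] by blast
  have "klin i d (ideal_vecs (monomial_ideal (set (take j us)) :: ('n, 'k) poly_ring set))" if "j \<le> length us" for i j
    using that
  proof (induction j)
    case 0
    show ?case by (simp add: klin_zero_ideal)
  next
    case (Suc j)
    have "\<exists>V. colon (monomial_ideal (set (take j us))) (mono_poly (us ! j) :: ('n, 'k) poly_ring) = monomial_ideal (mvar ` V)"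
    proof (cases "j = 0")
      case True
      then show ?thesis using colon_zero_ideal by (intro exI[of _ "{}"]) simp
    next
      case False
      then show ?thesis using us[of j] Suc.prems by (simp add: One_nat_def)
    qed
    moreover have "mdeg (us ! j) = d" using Suc.prems L set_us by (auto intro: nth_mem)
    ultimately have "klin i d (ideal_vecs (monomial_ideal (insert (us ! j) (set (take j us))) :: ('n, 'k) poly_ring set))"
      using klin_insert[of i "us ! j" "set (take j us)", where 'k = 'k] Suc by auto
    then show ?case using Suc.prems by (simp add: take_Suc_conv_app_nth)
  qed
  from this[of "length us"] have "klin i d (ideal_vecs (monomial_ideal L :: ('n, 'k) poly_ring set))" for i
    by (simp add: set_us)
  then show ?thesis
    using klin_imp_linear_resolution[OF _ subspace_ideal_vecs[OF subspace_monomial_ideal] graded_ideal_vecs]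
      ord_ge_monomial_ideal[OF L] by blast
qed

section \<open>An obstruction to linear resolutions\<close>

text \<open>
  Under the hypotheses the multidegree of \<open>p * \<Prod>i\<noteq>a. x\<^sub>i\<close> carries a nonzero class of Koszul
  homology in degree one higher than the linear strand: the boundary of \<open>p e\<^sub>\<sigma>\<close>, where \<open>\<sigma>\<close> consists of
  all variables but \<open>a\<close>.
\<close>

lemma nonlinear_Koszul_class:
  fixes L :: "'n::{finite,linorder} pmonom set"
  assumes L: "\<And>t. t \<in> L \<Longrightarrow> mdeg t = d" and p: "mdeg p = d" "p \<notin> L"
    and ab: "a \<noteq> b" "0 < lookup p a" "p - mvar a + mvar b \<notin> L"
    and shad: "\<And>c. c \<noteq> a \<Longrightarrow> p + mvar c \<in> Shad L"
  shows "\<not> klin (card (UNIV :: 'n set) - 2) d (ideal_vecs (monomial_ideal L :: ('n, 'k::field) poly_ring set))"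
proof
  let ?I = "monomial_ideal L :: ('n, 'k) poly_ring set"
  assume lin: "klin (card (UNIV :: 'n set) - 2) d (ideal_vecs ?I)"
  \<comment> \<open>Since \<open>p\<close> is not in \<open>L\<close>, this chain has a coefficient
    outside the ideal; only its boundary will have coefficients inside.\<close>
  define e :: "'n set \<Rightarrow> nat \<Rightarrow> ('n, 'k) poly_ring" where
    "e \<tau> = (\<lambda>j. if \<tau> = UNIV - {a} \<and> j = 0 then mono_poly p else 0)" for \<tau>
  \<comment> \<open>Two distinct variables make the subtraction of 2 on natural numbers
    exact.\<close>
  have "card {a, b} \<le> card (UNIV :: 'n set)" by (rule card_mono) auto
  then have card2: "2 \<le> card (UNIV :: 'n set)" using ab(1) by simp
  have "e \<in> kchain (Suc (card (UNIV :: 'n set) - 2)) (free_module 1)"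
    using card2 by (auto simp: kchain_def e_def free_module_def fun_eq_iff card_Diff_subset)
  then have de: "kdiff e \<in> kchain (card (UNIV :: 'n set) - 2) (free_module 1)"
    by (rule kchain_kdiff[OF _ subspace_free_module])
  have "kdiff e \<tau> 0 \<in> ?I" for \<tau>
    unfolding monomial_ideal_iff
  proof
    fix s assume "s \<in> keys (kdiff e \<tau> 0)"
    then have "(\<Sum>i | i \<notin> \<tau> \<and> 0 < lookup s i. ksign i \<tau> * lookup (e (insert i \<tau>) 0) (s - mvar i)) \<noteq> 0"
      by (simp add: in_keys_iff lookup_kdiff)
    then obtain i where i: "i \<notin> \<tau>" "0 < lookup s i" "lookup (e (insert i \<tau>) 0) (s - mvar i) \<noteq> 0"
      by (rule sum.not_neutral_contains_not_neutral) auto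
    then have "s - mvar i = p" "i \<noteq> a"
      by (auto simp: e_def mono_poly_def lookup_single when_def split: if_splits)
    then have "s \<in> Shad L" using shad[of i] minus_mvar_add[OF i(2)] by auto
    then show "\<exists>m\<in>L. mdvd m s" by (auto simp: Shad_def mdvd_def)
  qed
  then have deI: "kdiff e \<in> kchain (card (UNIV :: 'n set) - 2) (ideal_vecs ?I)"
    using de by (simp add: kchain_def)
  have e_ord: "ord_ge (Suc d) (kdiff e \<sigma> j)" for \<sigma> j
    by (rule ord_ge_kdiff) (simp add: e_def ord_ge_def mono_poly_def p(1))
  obtain y where y: "y \<in> kchain (Suc (card (UNIV :: 'n set) - 2)) (ideal_vecs ?I)" "kdiff y = kdiff e"
    by (rule klinD[OF lin deI kdiff_kdiff e_ord])
  have y0: "lookup (y \<tau> 0) t = 0" if "mdeg t = d" "t \<notin> L" for \<tau> t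
  proof (rule ccontr)
    assume "lookup (y \<tau> 0) t \<noteq> 0"
    then have "t \<in> keys (y \<tau> 0)" by (simp add: in_keys_iff)
    then obtain m where "m \<in> L" "mdvd m t"
      using kchainD(1)[OF y(1), of \<tau>] unfolding monomial_ideal_iff by blast
    then show False using that L mdvd_mdeg_eq[of m t] by auto
  qed
  \<comment> \<open>Compare the coefficients of p x_b at the basis element missing \<open>a\<close>
    and \<open>b\<close>. In \<open>kdiff y\<close> they can only come from p or from p x_b / x_a,
    neither of which is in \<open>L\<close>; in \<open>kdiff e\<close> the monomial p contributes a
    sign.\<close>
  define \<sigma> where "\<sigma> = UNIV - {a, b}"
  define s where "s = p + mvar b"
  have ab_eq: "{i. i \<notin> \<sigma> \<and> 0 < lookup s i} = {a, b}"
    using ab(2) by (auto simp: \<sigma>_def s_def lookup_add lookup_single)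
  have ins: "insert a \<sigma> = UNIV - {b}" "insert b \<sigma> = UNIV - {a}"
    using ab(1) by (auto simp: \<sigma>_def)
  have sa: "s - mvar a = p - mvar a + mvar b"
    using ab by (intro poly_mapping_eqI) (auto simp: s_def lookup_add lookup_minus lookup_single when_def)
  have sb: "s - mvar b = p" by (simp add: s_def)
  have "mdeg (s - mvar a) = d"
    using ab(2) mdeg_add[of "s - mvar a" "mvar a"]
    by (simp add: minus_mvar_add s_def lookup_add mdeg_add p(1))
  then have "lookup (kdiff y \<sigma> 0) s = 0"
    using ab(1,3) p y0 by (simp add: lookup_kdiff ab_eq sa sb)
  moreover have "lookup (kdiff e \<sigma> 0) s = ksign b \<sigma>"
  proof -
    have "UNIV - {b} \<noteq> UNIV - {a}" using ab(1) by blast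
    then show ?thesis
      using ab(1) by (simp add: lookup_kdiff ab_eq ins sb e_def mono_poly_def)
  qed
  moreover have "ksign b \<sigma> \<noteq> (0 :: 'k)" by (simp add: ksign_def)
  ultimately show False using y(2) by simp
qed

section \<open>Lexsegments with linear quotients\<close>

lemma pmonom_less_iff: "s < t \<longleftrightarrow> (\<exists>k. lookup s k < lookup t k \<and> (\<forall>k'<k. lookup s k' = lookup t k'))"
  for s t :: "'n::linorder pmonom"
  by transfer (simp add: less_fun_def)

lemma lookup_Min_mono: "s \<le> t \<Longrightarrow> lookup s (Min UNIV) \<le> lookup t (Min UNIV)"
  for s t :: "'n::{finite,linorder} pmonom"
  by (metis Min_le UNIV_I finite le_less nless_le order_le_less pmonom_less_iff)

lemma less_if_lookup_Min: "lookup s (Min UNIV) < lookup t (Min UNIV) \<Longrightarrow> s < t"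
  for s t :: "'n::{finite,linorder} pmonom"
  by (meson leD lookup_Min_mono not_le)

lemma mvar_antimono: "i \<le> j \<Longrightarrow> mvar j \<le> mvar i" for i j :: "'n::linorder"
proof (cases "i = j")
  case False
  moreover assume "i \<le> j"
  ultimately have "mvar j < mvar i"
    unfolding pmonom_less_iff by (intro exI[of _ i]) (auto simp: lookup_single when_def)
  then show ?thesis by simp
qed simp

lemma mdeg_strict_mono:
  assumes "\<And>k. lookup s k \<le> lookup t k" "lookup s i < lookup t i"
  shows "mdeg s < mdeg t"
  unfolding mdeg_def using assms by (intro sum_strict_mono_ex1) auto

lemma equigenerated_minimal:
  assumes "\<And>t. t \<in> L \<Longrightarrow> mdeg t = d"
  shows "minimal_monomial_generating_set (monomial_ideal L :: ('n::finite, 'k::field) poly_ring set) L"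
  unfolding minimal_monomial_generating_set_def
proof (intro conjI allI impI refl notI)
  fix G' assume "G' \<subset> L" "(monomial_ideal L :: ('n, 'k) poly_ring set) = monomial_ideal G'"
  then have eq: "(\<exists>m\<in>L. mdvd m t) \<longleftrightarrow> (\<exists>m\<in>G'. mdvd m t)" for t
    by (simp add: monomial_ideal_eq_iff)
  obtain t where t: "t \<in> L" "t \<notin> G'" using \<open>G' \<subset> L\<close> by blast
  then obtain m where m: "m \<in> G'" "mdvd m t" using eq mdvd_refl[of t] by blast
  then have "m = t" using \<open>G' \<subset> L\<close> t(1) assms by (intro mdvd_mdeg_eq) auto
  then show False using m(1) t(2) by simp
qed

text \<open>\<open>V\<close> collects the variables x_i with m x_i in the ideal. If m s is a
  multiple of m' in \<open>T\<close>, the index supplied by \<open>exch\<close> has a larger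
  exponent in m' than in m, so x_i divides s.\<close>

lemma colon_monomial_ideal:
  fixes m :: "'n::finite pmonom"
  assumes exch: "\<And>m'. m' \<in> T \<Longrightarrow> \<exists>i. lookup m i < lookup m' i \<and> (\<exists>m''\<in>T. mdvd m'' (m + mvar i))"
  obtains V where "colon (monomial_ideal T) (mono_poly m :: ('n, 'k::field) poly_ring) = monomial_ideal (mvar ` V)"
proof
  define V where "V = {i. \<exists>m''\<in>T. mdvd m'' (m + mvar i)}"
  have keys: "keys (g * mono_poly m) = (+) m ` keys g" for g :: "('n, 'k) poly_ring"
  proof -
    have "t \<in> keys (mono_poly m * g) \<longleftrightarrow> mdvd m t \<and> t - m \<in> keys g" for t
      by (simp add: in_keys_iff mono_poly_def lookup_single_mult)
    then show ?thesis by (force simp: mult.commute mdvd_def)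
  qed
  have "(\<exists>m'\<in>T. mdvd m' (m + s)) \<longleftrightarrow> (\<exists>i\<in>V. mdvd (mvar i) s)" for s
  proof
    assume "\<exists>m'\<in>T. mdvd m' (m + s)"
    then obtain m' where m': "m' \<in> T" "mdvd m' (m + s)" by blast
    obtain i where i: "lookup m i < lookup m' i" "i \<in> V"
      using exch[OF m'(1)] unfolding V_def by blast
    moreover have "lookup m' i \<le> lookup m i + lookup s i"
      using m'(2) by (simp add: mdvd_iff lookup_add)
    ultimately show "\<exists>i\<in>V. mdvd (mvar i) s" by (auto simp: mdvd_mvar_iff intro!: bexI[of _ i])
  next
    assume "\<exists>i\<in>V. mdvd (mvar i) s"
    then obtain i m'' r where "m'' \<in> T" "mdvd m'' (m + mvar i)" "s = mvar i + r"
      by (auto simp: V_def mdvd_def)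
    then have "mdvd m'' (m + s)" using mdvd_trans[of m'' "m + mvar i" "m + s"]
      by (auto simp: mdvd_def add.assoc)
    then show "\<exists>m'\<in>T. mdvd m' (m + s)" using \<open>m'' \<in> T\<close> by blast
  qed
  then show "colon (monomial_ideal T) (mono_poly m :: ('n, 'k) poly_ring) = monomial_ideal (mvar ` V)"
    by (intro set_eqI) (simp add: colon_def monomial_ideal_iff keys)
qed

section \<open>Condition (C) and linear quotients of a lexsegment\<close>

locale lex_quotients =
  fixes u v :: "'n::{finite,linorder} pmonom" and a b :: 'n
  assumes a_def: "a = Min UNIV" and b_def: "b = Max UNIV"
    and deg_v: "mdeg v = mdeg u"
    and u_a: "0 < lookup u a"
    and exchange_above: "\<And>p. mdeg p = mdeg u \<Longrightarrow> lookup p a = lookup u a \<Longrightarrow> u < p \<Longrightarrow>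
      v \<le> p - mvar a + mvar b"
begin

text \<open>Both exchanges used below lead to an earlier monomial: trading \<open>x_a\<close> for
  another variable lowers the first exponent, and trading x_t for x_i with a < i < t keeps that
  exponent and makes the monomial lexicographically larger.\<close>

definition prec :: "'n pmonom \<Rightarrow> 'n pmonom \<Rightarrow> bool" where
  "prec s t \<longleftrightarrow> lookup s a < lookup t a \<or> (lookup s a = lookup t a \<and> t < s)"

lemma a_le: "a \<le> i"
  by (simp add: a_def)

lemma exchange:
  assumes m: "m \<in> lexsegment u v" and m': "m' \<in> lexsegment u v" and less: "prec m' m"
  shows "\<exists>i. lookup m i < lookup m' i \<and>
    (\<exists>m''\<in>{x \<in> lexsegment u v. prec x m}. mdvd m'' (m + mvar i))"
proof -
  have deg: "mdeg m = mdeg u" "mdeg m' = mdeg u" and le: "v \<le> m" "m \<le> u" "v \<le> m'"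
    using m m' by (auto simp: lexsegment_def)
  have m_a: "lookup m a \<le> lookup u a" using lookup_Min_mono[OF le(2)] by (simp add: a_def)
  define S where "S = {i. i \<noteq> a \<and> lookup m i < lookup m' i}"
  \<comment> \<open>If the \<open>a\<close>-exponent drops, equal degrees force a rise elsewhere;
    otherwise the first difference of the two monomials is such an index.\<close>
  have "S \<noteq> {}"
  proof (cases "lookup m' a < lookup m a")
    case True
    have "\<exists>i. lookup m i < lookup m' i"
    proof (rule ccontr)
      assume "\<nexists>i. lookup m i < lookup m' i"
      then have "mdeg m' < mdeg m" using True by (intro mdeg_strict_mono[of _ _ a]) (auto simp: not_less)
      then show False using deg by simp
    qed
    then show ?thesis using True by (force simp: S_def)
  next
    case False
    then have "lookup m' a = lookup m a" "m < m'" using less by (auto simp: prec_def)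
    then show ?thesis by (force simp: S_def pmonom_less_iff)
  qed
  define i where "i = Min S"
  have i: "i \<noteq> a" "lookup m i < lookup m' i"
    using Min_in[OF finite \<open>S \<noteq> {}\<close>] by (auto simp: i_def S_def)
  have below: "lookup m' k \<le> lookup m k" if "k < i" "k \<noteq> a" for k
  proof -
    have "k \<notin> S" using Min_le[OF finite, of k S] that(1) unfolding i_def by (meson not_le)
    then show ?thesis using that(2) by (simp add: S_def)
  qed
  have "a < i" using a_le[of i] i(1) by simp
  define m1 where "m1 = m + mvar i - mvar a"
  have m1_lookup: "lookup m1 k = (if k = a then lookup m a - 1 else if k = i then Suc (lookup m i) else lookup m k)" for k
    using i(1) by (auto simp: m1_def lookup_add lookup_minus lookup_single when_def)
  have m1_deg: "mdeg m1 = mdeg u" if "0 < lookup m a"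
    using that mdeg_minus_mvar[of "m + mvar i" a] by (simp add: m1_def lookup_add mdeg_add deg)
  \<comment> \<open>If m has no variable beyond \<open>i\<close>, then \<open>s\<close> agrees with
    m' up to their first difference and is nowhere larger from there on, contradicting equal
    degrees. This is applied with m1 and with m in the role of \<open>s\<close>.\<close>
  have not_all_zero: False if zero: "\<And>t. i < t \<Longrightarrow> lookup m t = 0"
    and s: "mdeg s = mdeg u" "s < m'" "\<And>k. i < k \<Longrightarrow> lookup s k = lookup m k"
      "\<And>k. k < i \<Longrightarrow> lookup m' k \<le> lookup s k" for s
  proof -
    obtain k where k: "lookup s k < lookup m' k" "\<And>k'. k' < k \<Longrightarrow> lookup s k' = lookup m' k'"
      using s(2) by (auto simp: pmonom_less_iff)
    then have "i \<le> k" using s(4)[of k] by (meson not_less)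
    then have "lookup s k' \<le> lookup m' k'" for k'
      using k zero s(3) by (cases k' k rule: linorder_cases) auto
    then have "mdeg s < mdeg m'" using k(1) by (intro mdeg_strict_mono)
    then show False using s(1) deg by simp
  qed
  have main: "(0 < lookup m a \<and> v \<le> m1) \<or> (\<exists>t>i. 0 < lookup m t)"
  proof (rule ccontr)
    assume "\<not> ?thesis"
    then have zero: "\<And>t. i < t \<Longrightarrow> lookup m t = 0" and m1: "0 < lookup m a \<Longrightarrow> m1 < v"
      by (auto simp: not_le)
    show False
    proof (cases "lookup m' a < lookup m a")
      case True
      then have "m1 < m'" using m1 le(3) by simp
      moreover have "lookup m' k \<le> lookup m1 k" if "k < i" for k
        using below[OF that] True that by (auto simp: m1_lookup)
      moreover have "lookup m1 k = lookup m k" if "i < k" for k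
        using that \<open>a < i\<close> by (auto simp: m1_lookup)
      ultimately show False
        using not_all_zero[OF zero m1_deg] True by simp
    next
      case False
      then have *: "lookup m' a = lookup m a" "m < m'" using less by (auto simp: prec_def)
      then have "lookup m' k \<le> lookup m k" if "k < i" for k
        using below[OF that] by (cases "k = a") auto
      then show False using not_all_zero[OF zero deg(1) *(2)] by simp
    qed
  qed
  have case_m1: ?thesis if "0 < lookup m a" "v \<le> m1"
  proof -
    have "m1 < u" using that(1) m_a
      by (intro less_if_lookup_Min) (simp add: m1_lookup flip: a_def)
    then have "m1 \<in> lexsegment u v" using that m1_deg by (simp add: lexsegment_def)
    moreover have "prec m1 m" using that(1) by (simp add: prec_def m1_lookup)
    moreover have "mdvd m1 (m + mvar i)"
      by (simp add: m1_def mdvd_iff lookup_minus)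
    ultimately show ?thesis using i(2) by blast
  qed
  show ?thesis
  proof (cases "0 < lookup m a \<and> v \<le> m1")
    case True
    then show ?thesis using case_m1 by blast
  next
    case False
    then obtain t where t: "i < t" "0 < lookup m t" using main by blast
    define m2 where "m2 = m + mvar i - mvar t"
    have m2_lookup: "lookup m2 k = (if k = t then lookup m t - 1 else if k = i then Suc (lookup m i) else lookup m k)" for k
      using t(1) by (auto simp: m2_def lookup_add lookup_minus lookup_single when_def)
    have m2_deg: "mdeg m2 = mdeg u"
      using t(2) mdeg_minus_mvar[of "m + mvar i" t] by (simp add: m2_def lookup_add mdeg_add deg)
    have "m < m2"
      unfolding pmonom_less_iff using t(1) by (intro exI[of _ i]) (auto simp: m2_lookup)
    have m2_a: "lookup m2 a = lookup m a" using t(1) \<open>a < i\<close> by (auto simp: m2_lookup)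
    show ?thesis
    proof (cases "m2 \<le> u")
      case True
      then have "m2 \<in> lexsegment u v" using m2_deg le(1) \<open>m < m2\<close> by (simp add: lexsegment_def)
      moreover have "prec m2 m" using m2_a \<open>m < m2\<close> by (simp add: prec_def)
      moreover have "mdvd m2 (m + mvar i)"
        by (simp add: m2_def mdvd_iff lookup_minus)
      ultimately show ?thesis using i(2) by blast
    next
      case False
      then have "u < m2" by simp
      \<comment> \<open>The \<open>a\<close>-exponent of m2 is at least that of u because m2 > u,
        and at most that of u because it equals that of m. So (C) applies to m2.\<close>
      then have eq: "lookup m2 a = lookup u a"
        using lookup_Min_mono[of u m2] m2_a m_a by (simp add: a_def)
      then have "v \<le> m2 - mvar a + mvar b" using exchange_above m2_deg \<open>u < m2\<close> by blast
      also have "\<dots> \<le> m2 - mvar a + mvar t"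
        by (intro add_left_mono mvar_antimono) (simp add: b_def)
      also have "m2 - mvar a + mvar t = m1"
        using t \<open>a < i\<close> eq m2_a u_a
        by (intro poly_mapping_eqI)
          (auto simp: m1_lookup m2_lookup lookup_add lookup_minus lookup_single when_def)
      finally show ?thesis using case_m1 eq m2_a u_a by simp
    qed
  qed
qed

lemma has_linear_quotients:
  "has_linear_quotients (monomial_ideal (lexsegment u v) :: ('n, 'k::field) poly_ring set)"
proof -
  let ?L = "lexsegment u v"
  have "finite ?L"
    using finite_mdeg[where g = "mdeg u" and 'n = 'n] by (rule rev_finite_subset) (auto simp: lexsegment_def)
  interpret prec: linorder "\<lambda>s t. s = t \<or> prec s t" prec
    by standard (auto simp: prec_def)
  obtain us where us: "set us = ?L" "prec.sorted us" "distinct us"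
    using prec.finite_sorted_distinct_unique[OF \<open>finite ?L\<close>] by blast
  have take: "set (take j us) = {x \<in> ?L. prec x (us ! j)}" if j: "j < length us" for j
  proof (intro set_eqI iffI)
    fix x assume "x \<in> set (take j us)"
    then obtain i where i: "i < j" "x = us ! i" using j by (auto simp: in_set_conv_nth)
    then have "x = us ! j \<or> prec x (us ! j)"
      using prec.sorted_nth_mono[OF us(2), of i j] j by simp
    moreover have "x \<noteq> us ! j" using us(3) i j by (simp add: nth_eq_iff_index_eq)
    moreover have "x \<in> ?L" using nth_mem[of i us] i j us(1) by simp
    ultimately show "x \<in> {x \<in> ?L. prec x (us ! j)}" by blast
  next
    fix x assume x: "x \<in> {x \<in> ?L. prec x (us ! j)}"
    then have "x \<in> set us" using us(1) by simp
    then obtain i where i: "i < length us" "x = us ! i" by (auto simp: in_set_conv_nth)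
    have "i < j"
    proof (rule ccontr)
      assume "\<not> i < j"
      then have "us ! j = us ! i \<or> prec (us ! j) (us ! i)"
        using prec.sorted_nth_mono[OF us(2), of j i] i by simp
      then show False using x i by (auto simp: prec_def)
    qed
    then show "x \<in> set (take j us)" using i by (auto simp: in_set_conv_nth intro!: exI[of _ i])
  qed
  have "\<exists>V. colon (monomial_ideal (set (take j us))) (mono_poly (us ! j) :: ('n, 'k) poly_ring) = monomial_ideal (mvar ` V)"
    if j: "j < length us" for j
  proof -
    have "us ! j \<in> ?L" using nth_mem[OF j] us(1) by simp
    then have "\<exists>i. lookup (us ! j) i < lookup m' i \<and> (\<exists>m''\<in>set (take j us). mdvd m'' (us ! j + mvar i))"
      if "m' \<in> set (take j us)" for m'
      using that exchange unfolding take[OF j] by blast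
    then show ?thesis by (metis colon_monomial_ideal)
  qed
  moreover have "minimal_monomial_generating_set (monomial_ideal ?L :: ('n, 'k) poly_ring set) (set us)"
    unfolding us(1) by (rule equigenerated_minimal) (simp add: lexsegment_def)
  ultimately show ?thesis unfolding has_linear_quotients_def using us(3) by blast
qed

end

section \<open>The equivalence for completely lexsegment ideals\<close>

theorem theorem1p2:
  fixes u v :: "'n::{finite,linorder} \<Rightarrow>\<^sub>0 nat"
    and d :: nat
    and I :: "('n, 'k::field) poly_ring set"
  assumes "d \<ge> 2"
    and "mdeg u = d" and "mdeg v = d"
    and "Poly_Mapping.lookup u (Min UNIV) > 0"
    and "u \<ge> v"
    and "I = monomial_ideal (lexsegment u v)"
    and "completely_lexsegment_ideal I"
  shows "has_linear_resolution d I \<longleftrightarrow> has_linear_quotients I"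
proof
  have L: "mdeg t = d" if "t \<in> lexsegment u v" for t
    using that assms(2) by (simp add: lexsegment_def)
  show "has_linear_resolution d I" if "has_linear_quotients I"
    using linear_quotients_imp_linear_resolution[OF L] that assms(6) by simp
  assume lr: "has_linear_resolution d I"
  define a b :: 'n where "a = Min UNIV" and "b = Max UNIV"
  \<comment> \<open>The definition only provides some completely lexsegment \<open>T\<close>
    generating \<open>I\<close>. Its members share one degree, so it is a minimal generating set and
    must be the given lexsegment.\<close>
  obtain T where T: "completely_lexsegment T" "I = monomial_ideal T"
    using assms(7) by (auto simp: completely_lexsegment_ideal_def)
  have is_lex: "is_lexsegment T" "is_lexsegment (Shad T)"
    using T(1)[unfolded completely_lexsegment_def, rule_format, of 0]
      T(1)[unfolded completely_lexsegment_def, rule_format, of 1] by (simp_all add: One_nat_def)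
  obtain e where "\<And>t. t \<in> T \<Longrightarrow> mdeg t = e"
    using is_lex(1) by (auto simp: is_lexsegment_def lexsegment_def)
  then have "minimal_monomial_generating_set I T"
    unfolding T(2) by (rule equigenerated_minimal)
  then have T_eq: "T = lexsegment u v"
    using minimal_generators_equal[OF L] assms(6) by simp
  obtain u1 v1 where Shad: "Shad (lexsegment u v) = lexsegment u1 v1"
    using is_lex(2) unfolding T_eq is_lexsegment_def by blast
  have uv: "u \<in> lexsegment u v" "v \<in> lexsegment u v"
    using assms(2,3,5) by (auto simp: lexsegment_def)
  then have "u + mvar a \<in> lexsegment u1 v1" "v + mvar b \<in> lexsegment u1 v1"
    unfolding Shad[symmetric] by (auto simp: Shad_def)
  then have bounds: "u + mvar a \<le> u1" "v1 \<le> v + mvar b" "mdeg u1 = Suc d"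
    using assms(2) by (auto simp: lexsegment_def mdeg_add)
  have "lex_quotients u v a b"
  proof
    fix p assume p: "mdeg p = mdeg u" "lookup p a = lookup u a" "u < p"
    show "v \<le> p - mvar a + mvar b"
    proof (rule ccontr)
      assume not_ge: "\<not> v \<le> p - mvar a + mvar b"
      \<comment> \<open>With a single variable the first exponent determines the monomial, so
        \<open>p > u\<close> would be impossible.\<close>
      have "a \<noteq> b"
      proof
        assume "a = b"
        then have "k = a" for k
          by (metis Max_ge Min_le UNIV_I a_def antisym b_def finite)
        then have "p = u" using p(2) by (intro poly_mapping_eqI) metis
        then show False using p(3) by simp
      qed
      \<comment> \<open>The product p x_c lies between v x_b and u x_a; both belong to the shadow,
        which is a lexsegment.\<close>
      moreover have "p + mvar c \<in> Shad (lexsegment u v)" if "c \<noteq> a" for c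
      proof -
        have "v + mvar b \<le> p + mvar c"
          using assms(5) p(3) by (intro add_mono mvar_antimono) (auto simp: b_def)
        moreover have "p + mvar c < u + mvar a"
          using p(2) that by (intro less_if_lookup_Min) (simp add: lookup_add lookup_single flip: a_def)
        ultimately show ?thesis
          unfolding Shad using bounds p(1) assms(2) by (auto simp: lexsegment_def mdeg_add)
      qed
      moreover have "p \<notin> lexsegment u v" "p - mvar a + mvar b \<notin> lexsegment u v"
        using p(3) not_ge by (auto simp: lexsegment_def)
      ultimately have "\<not> klin (card (UNIV :: 'n set) - 2) d (ideal_vecs I)"
        unfolding assms(6) using p assms(2,4)
        by (intro nonlinear_Koszul_class[OF L, where p = p and a = a and b = b]) (auto simp: a_def)
      then show False using linear_resolution_imp_klin[OF lr] by blast
    qed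
  qed (use assms in \<open>simp_all add: a_def b_def\<close>)
  then show "has_linear_quotients I"
    unfolding assms(6) by (rule lex_quotients.has_linear_quotients)
qed

end
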